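(* Let $p\ge 5$ be a prime and $n$ a positive integer. Then \[ C_{np}^{*}\equiv C_n^{*}+p^2\left(\frac{p}{3}\right)B_{p-2}\!\left(\tfrac{1}{3}\right)\mathcal{C}_n^{*}\pmod{p^3}, \qquad\text{where}\quad \mathcal{C}_n^{*}=\frac{1}{2}\sum_{k=0}^{n-1}\binom{n}{k}^2\binom{2k}{k}(n-k)^2 . \]
   Context: For $n\in\mathbb{N}$, $C^{*}_n=\sum_{k=0}^n\binom{n}{k}^2\binom{2k}{k}$. The Bernoulli polynomials $B_m(x)$ are defined by $\frac{ze^{xz}}{e^z-1}=\sum_{m\ge0}B_m(x)\frac{z^m}{m!}$. $\left(\frac{p}{3}\right)$ is the Legendre symbol. For rationals $a,b$, $a\equiv b\pmod{p^m}$ means $(a-b)/p^m$ is a rational number whose denominator is not divisible by $p$. *)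

theory Defs
  imports "HOL-Computational_Algebra.Formal_Power_Series" "HOL-Number_Theory.Number_Theory"
begin

definition bernpoly :: "nat \<Rightarrow> rat \<Rightarrow> rat" where
  "bernpoly m x = fact m * fps_nth (fps_X * fps_exp x / (fps_exp 1 - 1)) m"

definition Cstar :: "nat \<Rightarrow> nat" where
  "Cstar n = (\<Sum>k=0..n. (n choose k)^2 * ((2*k) choose k))"

definition Cstar_cal :: "nat \<Rightarrow> rat" where
  "Cstar_cal n = (1/2) * (\<Sum>k=0..n-1. of_nat ((n choose k)^2 * ((2*k) choose k) * (n - k)^2))"

definition rat_cong :: "rat \<Rightarrow> rat \<Rightarrow> nat \<Rightarrow> nat \<Rightarrow> bool" where
  "rat_cong a b p m \<longleftrightarrow> \<not> (int p dvd snd (quotient_of ((a - b) / of_nat p ^ m)))"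

end

theory Submission
  imports Defs
begin

text \<open>
  Split the sum for $C^*_{np}$ by the residue of $k$ modulo $p$. By the cubic congruence
  $\binom{np}{jp} \equiv \binom{n}{j} \pmod{p^3}$ the terms $k = jp$ add up to $C^*_n$. For
  $k = jp + r$ with $0 < r < p$ the square $\binom{np}{k}^2$ already carries a factor $p^2$, so
  Lucas' theorem suffices, and the terms factor as
  $p^2 (n-j)^2 \binom{n}{j}^2 \binom{2j}{j} \cdot \binom{2r}{r} / r^2$.

  It remains to find $\sum_{0<r<p} \binom{2r}{r} / r^2$ modulo $p$. Let $c_k = \alpha^k + \alpha^{-k}$
  for a primitive sixth root of unity $\alpha$. Expanding $c_k$ as an alternating sum of binomial
  coefficients and interchanging summations shows that this sum is $2 \sum_{0<k<p} c_k / k^2$; the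
  inner sums $\sum_k \binom{k-a}{b} / k$ are harmonic differences modulo $p$. The reflection
  $k \mapsto p - k$ and the doubling $k \mapsto 2k$ reduce the sum over the $c_k$ to
  $\sum_{k \le p/3} 1/k^2 \equiv \sum_{k \le p/3} k^{p-3}$, which is a value of a Bernoulli polynomial.
\<close>

section \<open>Congruences between p-integral rationals\<close>

text \<open>Membership in the localization of the integers at p, read off the reduced denominator so
  that \<open>rat_cong\<close> unfolds to integrality of (a - b) / p^m.\<close>

definition rat_integral :: "nat \<Rightarrow> rat \<Rightarrow> bool" where
  "rat_integral p x \<longleftrightarrow> \<not> int p dvd snd (quotient_of x)"

locale prime_ge5 =
  fixes p :: nat
  assumes prime: "prime p" and ge5: "p \<ge> 5"
begin

abbreviation pint :: "rat \<Rightarrow> bool" where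
  "pint \<equiv> rat_integral p"

abbreviation cong1 :: "rat \<Rightarrow> rat \<Rightarrow> bool" (infix "\<approx>" 50) where
  "a \<approx> b \<equiv> rat_cong a b p 1"

lemma prime_int: "prime (int p)"
  using prime by simp

lemma p_pos: "p > 0"
  using ge5 by simp

text \<open>The reduced denominator divides every other denominator, so any representation with a
  denominator prime to p will do. Closure under sums and products then follows from
  primality.\<close>

lemma pint_iff: "pint x \<longleftrightarrow> (\<exists>a b::int. \<not> int p dvd b \<and> x = of_int a / of_int b)"
proof
  assume "pint x"
  then show "\<exists>a b::int. \<not> int p dvd b \<and> x = of_int a / of_int b"
    unfolding rat_integral_def using quotient_of_div[of x] by (metis prod.collapse)
next
  assume "\<exists>a b::int. \<not> int p dvd b \<and> x = of_int a / of_int b"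
  then obtain a b where ab: "\<not> int p dvd b" "x = of_int a / of_int b" by blast
  obtain c d where q: "quotient_of x = (c, d)" by fastforce
  have d: "d > 0" "coprime c d" "x = of_int c / of_int d"
    using q quotient_of_denom_pos quotient_of_coprime quotient_of_div by auto
  have "b \<noteq> 0" using ab by auto
  then have "(of_int (c * b) :: rat) = of_int (a * d)"
    using d ab by (simp add: field_simps)
  then have "c * b = a * d" by (simp only: of_int_eq_iff)
  then have "d dvd c * b" by simp
  then have "d dvd b" using d(2) by (simp add: coprime_commute coprime_dvd_mult_right_iff)
  then show "pint x" unfolding rat_integral_def q using ab(1) by (auto dest: dvd_trans)
qed

lemma pint_of_int [simp]: "pint (of_int a)"
  unfolding pint_iff using prime by (intro exI[of _ a] exI[of _ 1]) auto

lemma pint_of_nat [simp]: "pint (of_nat a)"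
  using pint_of_int[of "int a"] by simp

lemma pint_0 [simp]: "pint 0" and pint_1 [simp]: "pint 1"
  and pint_numeral [simp]: "pint (numeral k)"
  using pint_of_nat[of 0] pint_of_nat[of 1] pint_of_nat[of "numeral k"] by simp_all

lemma pint_add [intro]: assumes "pint x" "pint y" shows "pint (x + y)"
proof -
  obtain a b c d where *: "\<not> int p dvd b" "x = of_int a / of_int b"
    "\<not> int p dvd d" "y = of_int c / of_int d"
    using assms unfolding pint_iff by blast
  then have "b \<noteq> 0" "d \<noteq> 0" by auto
  then have "x + y = of_int (a * d + c * b) / of_int (b * d)"
    using * by (simp add: field_simps)
  moreover have "\<not> int p dvd b * d"
    using * prime_dvd_mult_iff[OF prime_int] by blast
  ultimately show ?thesis unfolding pint_iff by blast
qed

lemma pint_mult [intro]: assumes "pint x" "pint y" shows "pint (x * y)"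
proof -
  obtain a b c d where *: "\<not> int p dvd b" "x = of_int a / of_int b"
    "\<not> int p dvd d" "y = of_int c / of_int d"
    using assms unfolding pint_iff by blast
  then have "x * y = of_int (a * c) / of_int (b * d)" by simp
  moreover have "\<not> int p dvd b * d"
    using * prime_dvd_mult_iff[OF prime_int] by blast
  ultimately show ?thesis unfolding pint_iff by blast
qed

lemma pint_minus [intro]: "pint x \<Longrightarrow> pint (- x)"
  using pint_mult[OF pint_of_int[of "- 1"], of x] by simp

lemma pint_diff [intro]: "pint x \<Longrightarrow> pint y \<Longrightarrow> pint (x - y)"
  using pint_add[of x "- y"] by auto

lemma pint_power [intro]: "pint x \<Longrightarrow> pint (x ^ n)"
  by (induction n) auto

lemma pint_sum [intro]: "(\<And>i. i \<in> A \<Longrightarrow> pint (f i)) \<Longrightarrow> pint (sum f A)"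
  by (induction A rule: infinite_finite_induct) auto

lemma pint_prod [intro]: "(\<And>i. i \<in> A \<Longrightarrow> pint (f i)) \<Longrightarrow> pint (prod f A)"
  by (induction A rule: infinite_finite_induct) auto

lemma pint_inverse_nat: "\<not> p dvd k \<Longrightarrow> pint (1 / of_nat k)"
  unfolding pint_iff by (intro exI[of _ 1] exI[of _ "int k"]) simp

lemma pint_divide_nat: "\<not> p dvd k \<Longrightarrow> pint x \<Longrightarrow> pint (x / of_nat k)"
  using pint_mult[OF _ pint_inverse_nat, of x k] by simp

lemma not_dvd_lt: "0 < k \<Longrightarrow> k < p \<Longrightarrow> \<not> p dvd k"
  by (auto dest: dvd_imp_le)

section \<open>Calculus of congruences modulo powers of p\<close>

lemma rat_cong_iff: "rat_cong a b p m \<longleftrightarrow> (\<exists>z. pint z \<and> a = b + of_nat p ^ m * z)"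
proof -
  have "rat_cong a b p m \<longleftrightarrow> pint ((a - b) / of_nat p ^ m)"
    by (simp add: rat_cong_def rat_integral_def)
  also have "\<dots> \<longleftrightarrow> (\<exists>z. pint z \<and> (a - b) / of_nat p ^ m = z)" by simp
  also have "\<dots> \<longleftrightarrow> (\<exists>z. pint z \<and> a = b + of_nat p ^ m * z)"
    using p_pos by (intro ex_cong1) (auto simp: field_simps)
  finally show ?thesis .
qed

lemma rat_congI: "pint z \<Longrightarrow> a = b + of_nat p ^ m * z \<Longrightarrow> rat_cong a b p m"
  unfolding rat_cong_iff by blast

lemma rat_cong_refl [simp]: "rat_cong a a p m"
  by (rule rat_congI[of 0]) auto

lemma rat_cong_sym: assumes "rat_cong a b p m" shows "rat_cong b a p m"
proof -
  obtain z where "pint z" "a = b + of_nat p ^ m * z" using assms unfolding rat_cong_iff by blast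
  then show ?thesis by (intro rat_congI[of "- z"]) (auto simp: algebra_simps)
qed

lemma rat_cong_add:
  assumes "rat_cong a b p m" "rat_cong c d p m" shows "rat_cong (a + c) (b + d) p m"
proof -
  obtain z w where "pint z" "a = b + of_nat p ^ m * z" "pint w" "c = d + of_nat p ^ m * w"
    using assms unfolding rat_cong_iff by blast
  then show ?thesis by (intro rat_congI[of "z + w"]) (auto simp: algebra_simps)
qed

lemma rat_cong_trans [trans]:
  assumes "rat_cong a b p m" "rat_cong b c p m" shows "rat_cong a c p m"
proof -
  obtain z w where "pint z" "a = b + of_nat p ^ m * z" "pint w" "b = c + of_nat p ^ m * w"
    using assms unfolding rat_cong_iff by blast
  then show ?thesis by (intro rat_congI[of "z + w"]) (auto simp: algebra_simps)
qed

lemma rat_cong_scale: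
  assumes "pint c" "rat_cong a b p m" shows "rat_cong (c * a) (c * b) p m"
proof -
  obtain z where "pint z" "a = b + of_nat p ^ m * z" using assms unfolding rat_cong_iff by blast
  then show ?thesis using assms by (intro rat_congI[of "c * z"]) (auto simp: algebra_simps)
qed

lemma rat_cong_divide_nat:
  "\<not> p dvd k \<Longrightarrow> rat_cong a b p m \<Longrightarrow> rat_cong (a / of_nat k) (b / of_nat k) p m"
  using rat_cong_scale[OF pint_inverse_nat, of k a b m] by simp

lemma rat_cong_minus: "rat_cong a b p m \<Longrightarrow> rat_cong (- a) (- b) p m"
  using rat_cong_scale[of "- 1" a b m] pint_minus[of 1] by simp

lemma rat_cong_diff:
  "rat_cong a b p m \<Longrightarrow> rat_cong c d p m \<Longrightarrow> rat_cong (a - c) (b - d) p m"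
  using rat_cong_add[of a b m "- c" "- d"] rat_cong_minus[of c d m] by simp

text \<open>First a is exchanged for b with multiplier c, then c for d with multiplier b; hence
  integrality is asked of b and c.\<close>

lemma rat_cong_mult:
  assumes "rat_cong a b p m" "rat_cong c d p m" "pint b" "pint c"
  shows "rat_cong (a * c) (b * d) p m"
proof -
  have "rat_cong (c * a) (c * b) p m" using assms by (intro rat_cong_scale)
  moreover have "rat_cong (b * c) (b * d) p m" using assms by (intro rat_cong_scale)
  ultimately show ?thesis using rat_cong_trans[of "a * c" "b * c" m "b * d"] by (simp add: mult.commute)
qed

lemma rat_cong_pint: assumes "rat_cong a b p m" "pint b" shows "pint a"
  using assms unfolding rat_cong_iff by (auto intro!: pint_add pint_mult pint_power)

lemma rat_cong_power:
  assumes "rat_cong a b p m" "pint b" shows "rat_cong (a ^ n) (b ^ n) p m"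
proof (induction n)
  case (Suc n)
  have "pint a" using assms rat_cong_pint by blast
  then show ?case using Suc assms by (auto intro: rat_cong_mult)
qed simp

lemma rat_cong_sum:
  "(\<And>i. i \<in> A \<Longrightarrow> rat_cong (f i) (g i) p m) \<Longrightarrow> rat_cong (sum f A) (sum g A) p m"
  by (induction A rule: infinite_finite_induct) (auto intro: rat_cong_add)

lemma rat_cong_prod:
  assumes "\<And>i. i \<in> A \<Longrightarrow> rat_cong (f i) (g i) p m" "\<And>i. i \<in> A \<Longrightarrow> pint (g i)"
  shows "rat_cong (prod f A) (prod g A) p m"
  using assms
proof (induction A rule: infinite_finite_induct)
  case (insert x A)
  have "\<And>i. i \<in> A \<Longrightarrow> pint (f i)"
    using insert.prems rat_cong_pint by blast
  then show ?case using insert by (auto intro!: rat_cong_mult)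
qed auto

text \<open>Lets terms carrying an explicit factor p^2 be evaluated modulo p only.\<close>

lemma rat_cong_lift:
  assumes "a \<approx> b" shows "rat_cong (of_nat p ^ 2 * a) (of_nat p ^ 2 * b) p 3"
proof -
  obtain z where "pint z" "a = b + of_nat p ^ 1 * z" using assms unfolding rat_cong_iff by blast
  then show ?thesis
    by (intro rat_congI[of z]) (auto simp: algebra_simps power2_eq_square power3_eq_cube)
qed

lemma rat_cong_of_nat: assumes "[a = b] (mod p ^ m)" shows "rat_cong (of_nat a) (of_nat b) p m"
proof -
  have "[int a = int b] (mod int p ^ m)"
    using assms by (metis cong_int_iff of_nat_power)
  then obtain k where "int a = int b + int p ^ m * k"
    by (metis cong_iff_lin cong_sym mult.commute)
  then have "(of_int (int a) :: rat) = of_int (int b + int p ^ m * k)" by simp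
  then show ?thesis by (intro rat_congI[of "of_int k"]) auto
qed

lemma cong_add_p: "pint y \<Longrightarrow> x + of_nat p * y \<approx> x"
  by (rule rat_congI[of y]) auto

text \<open>Multiply the congruence by c / (ab). The sign c is kept general: -1 serves the
  reflection of k to p - k, and 1 serves the shift from r to jp + r.\<close>

lemma cong_inverse:
  assumes "of_nat a \<approx> c * of_nat b" "\<not> p dvd a" "\<not> p dvd b" "c * c = 1" "pint c"
  shows "1 / of_nat a \<approx> c / of_nat b"
proof -
  have nz: "(of_nat a :: rat) \<noteq> 0" "(of_nat b :: rat) \<noteq> 0" using assms(2,3) by (auto intro!: Nat.gr0I)
  have "1 / of_nat a * (1 / of_nat b) * c * of_nat a \<approx>
      1 / of_nat a * (1 / of_nat b) * c * (c * of_nat b)"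
    by (intro rat_cong_scale pint_mult pint_inverse_nat assms)
  moreover have "1 / of_nat a * (1 / of_nat b) * c * of_nat a = c / (of_nat b :: rat)"
    using nz by simp
  moreover have "1 / of_nat a * (1 / of_nat b) * c * (c * of_nat b) = 1 / (of_nat a :: rat)"
    using nz assms(4) by (simp add: field_simps)
  ultimately show ?thesis using rat_cong_sym[of "c / of_nat b" "1 / of_nat a" 1] by simp
qed

lemma cong_inverse_reflect:
  assumes "0 < k" "k < p" shows "1 / of_nat (p - k) \<approx> - 1 / of_nat k"
proof (rule cong_inverse)
  show "of_nat (p - k) \<approx> - 1 * of_nat k"
    using assms by (intro rat_congI[of 1]) (auto simp: of_nat_diff)
  show "\<not> p dvd p - k" "\<not> p dvd k" using assms not_dvd_lt[of k] not_dvd_lt[of "p - k"] by simp_all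
  show "pint (- 1)" by (rule pint_minus) simp
qed simp

lemma cong_inverse_square_reflect:
  assumes "0 < k" "k < p" shows "1 / of_nat (p - k) ^ 2 \<approx> 1 / of_nat k ^ 2"
proof -
  have "(1 / of_nat (p - k)) ^ 2 \<approx> (- 1 / of_nat k) ^ 2"
    using assms by (intro rat_cong_power cong_inverse_reflect pint_divide_nat)
      (auto simp: not_dvd_lt)
  then show ?thesis by (simp add: power_divide)
qed

lemma pint_inverse_square: "0 < k \<Longrightarrow> k < p \<Longrightarrow> pint (1 / of_nat k ^ 2)"
  using pint_power[OF pint_inverse_nat[OF not_dvd_lt[of k]], of 2] by (simp add: power_divide)

lemma p_mod_3: "p mod 3 = 1 \<or> p mod 3 = 2"
proof -
  have "\<not> 3 dvd p" using prime ge5 primes_dvd_imp_eq[of 3 p] by auto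
  then show ?thesis by (simp add: dvd_eq_mod_eq_0) linarith
qed

lemma odd_p: "odd p"
  using prime_odd_nat[OF prime] ge5 by linarith

end

section \<open>Bernoulli polynomials modulo p\<close>

text \<open>The series e^z - 1 is not a unit, so the quotient is exact only because the numerator
  also has subdegree at least 1.\<close>

lemma bernpoly_fps_mult:
  fixes x :: rat
  shows "fps_X * fps_exp x / (fps_exp 1 - 1) * (fps_exp 1 - 1) = fps_X * fps_exp x"
proof -
  let ?E = "fps_exp 1 - 1 :: rat fps"
  have E1: "fps_nth ?E 1 \<noteq> 0" by simp
  then have E: "?E \<noteq> 0" by (metis fps_zero_nth)
  have "subdegree ?E \<le> 1" using E1 by (rule subdegree_leI)
  moreover have "fps_nth (fps_X * fps_exp x) 1 \<noteq> 0" by simp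
  then have nz: "fps_X * fps_exp x \<noteq> 0" by (metis fps_zero_nth)
  then have "subdegree (fps_X * fps_exp x) \<ge> 1"
    by (intro subdegree_geI) auto
  ultimately have "?E dvd fps_X * fps_exp x"
    using fps_dvd_iff[OF E nz] by simp
  then show ?thesis by (rule dvd_div_mult_self)
qed

lemma fps_exp_1_minus_1_nonzero: "fps_exp 1 - 1 \<noteq> (0 :: rat fps)"
proof -
  have "fps_nth (fps_exp 1 - 1 :: rat fps) 1 \<noteq> 0" by simp
  then show ?thesis by (metis fps_zero_nth)
qed

text \<open>Cancelling e^z - 1 turns an identity for Bernoulli polynomials into a product identity
  of power series.\<close>

lemma bernpoly_fps_unique:
  fixes F :: "rat fps"
  assumes "F * (fps_exp 1 - 1) = fps_X * fps_exp x"
  shows "bernpoly m x = fact m * fps_nth F m"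
proof -
  have "fps_X * fps_exp x / (fps_exp 1 - 1) = F"
    using bernpoly_fps_mult[of x] assms fps_exp_1_minus_1_nonzero by (metis mult_right_cancel)
  then show ?thesis by (simp add: bernpoly_def)
qed

text \<open>From e^((x+1)z) = e^(xz) + e^(xz) (e^z - 1). At m = 0 the truncated exponent is
  harmless, since its term has the factor 0.\<close>

lemma bernpoly_add_1: "bernpoly m (x + 1) = bernpoly m x + of_nat m * x ^ (m - 1)"
proof -
  let ?E = "fps_exp 1 - 1 :: rat fps" and ?F = "fps_X * fps_exp x / (fps_exp 1 - 1)"
  have "(?F + fps_X * fps_exp x) * ?E = fps_X * fps_exp x + fps_X * fps_exp x * ?E"
    using bernpoly_fps_mult[of x] by (simp add: algebra_simps)
  also have "\<dots> = fps_X * fps_exp (x + 1)"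
    by (simp add: fps_exp_add_mult algebra_simps)
  finally have "bernpoly m (x + 1) = fact m * fps_nth (?F + fps_X * fps_exp x) m"
    by (rule bernpoly_fps_unique)
  also have "\<dots> = bernpoly m x + of_nat m * x ^ (m - 1)"
    by (cases m) (simp_all add: bernpoly_def algebra_simps)
  finally show ?thesis .
qed

text \<open>Substitute -z for z and use e^z - 1 = - e^z (e^(-z) - 1).\<close>

lemma bernpoly_reflect: "bernpoly m (1 - x) = (- 1) ^ m * bernpoly m x"
proof -
  let ?F = "fps_X * fps_exp x / (fps_exp 1 - 1) :: rat fps" and ?N = "fps_const (- 1) * fps_X :: rat fps"
  have "(?F * (fps_exp 1 - 1)) oo ?N = (fps_X * fps_exp x) oo ?N"
    using bernpoly_fps_mult[of x] by simp
  then have *: "(?F oo ?N) * (fps_exp (- 1) - 1) = - fps_X * fps_exp (- x)"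
    by (simp add: fps_compose_mult_distrib fps_compose_sub_distrib del: fps_const_neg)
      (simp flip: fps_const_neg)
  have "(?F oo ?N) * (fps_exp 1 - 1) = - fps_exp 1 * ((?F oo ?N) * (fps_exp (- 1) - 1))"
    using fps_exp_add_mult[of 1 "- 1 :: rat"] by (simp add: algebra_simps)
  also have "\<dots> = fps_X * fps_exp (1 - x)"
    using fps_exp_add_mult[of 1 "- x"] unfolding * by (simp add: algebra_simps)
  finally have "bernpoly m (1 - x) = fact m * fps_nth (?F oo ?N) m"
    by (rule bernpoly_fps_unique)
  then show ?thesis by (simp add: bernpoly_def fps_compose_linear)
qed

text \<open>The generating function at x is the one at 0 times e^(xz); compare coefficients in the
  Cauchy product.\<close>

lemma bernpoly_expand:
  "bernpoly m x = (\<Sum>i\<le>m. of_nat (m choose i) * bernpoly i 0 * x ^ (m - i))"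
proof -
  let ?F = "fps_X * fps_exp 0 / (fps_exp 1 - 1) :: rat fps"
  have "(?F * fps_exp x) * (fps_exp 1 - 1) = (?F * (fps_exp 1 - 1)) * fps_exp x"
    by (simp only: mult_ac)
  also have "\<dots> = fps_X * fps_exp x"
    unfolding bernpoly_fps_mult by simp
  finally have "bernpoly m x = fact m * fps_nth (?F * fps_exp x) m"
    by (rule bernpoly_fps_unique)
  also have "\<dots> = (\<Sum>i\<le>m. fact m * (fps_nth ?F i * (x ^ (m - i) / fact (m - i))))"
    by (simp add: fps_mult_nth sum_distrib_left atLeast0AtMost)
  also have "\<dots> = (\<Sum>i\<le>m. of_nat (m choose i) * bernpoly i 0 * x ^ (m - i))"
    by (intro sum.cong refl) (simp add: bernpoly_def binomial_fact)
  finally show ?thesis .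
qed

lemma bernpoly_0_0: "bernpoly 0 0 = 1"
  using bernpoly_add_1[of 1 0] bernpoly_expand[of 1 1] by simp

text \<open>The expansion of B_{m+1}(1) has last term B_{m+1}(0), and these two values agree by the
  difference equation at 0.\<close>

lemma bernpoly_0_sum:
  assumes "m \<ge> 1" shows "(\<Sum>i\<le>m. of_nat (Suc m choose i) * bernpoly i 0) = 0"
  using bernpoly_add_1[of "Suc m" 0] bernpoly_expand[of "Suc m" 1] assms by simp

text \<open>The difference equation makes the values at 0 and 1 equal, the reflection makes them
  opposite.\<close>

lemma bernpoly_odd:
  assumes "odd m" "m \<ge> 2" shows "bernpoly m 0 = 0" "bernpoly m 1 = 0"
proof -
  have "(0 :: rat) ^ (m - 1) = 0" using assms by (simp add: power_0_left)
  then have "bernpoly m 1 = bernpoly m 0" using bernpoly_add_1[of m 0] by simp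
  then show "bernpoly m 0 = 0" "bernpoly m 1 = 0"
    using bernpoly_reflect[of m 0] assms by simp_all
qed

lemma sum_power_bernpoly:
  "of_nat m * (\<Sum>k=1..M. of_nat k ^ (m - 1)) = bernpoly m (of_nat M + 1) - bernpoly m 1"
proof (induction M)
  case (Suc M)
  then show ?case
    using bernpoly_add_1[of m "of_nat M + 1"] by (simp add: algebra_simps)
qed simp

lemma Legendre_3:
  "Legendre a 3 = (if a mod 3 = 0 then 0 else if a mod 3 = 1 then 1 else - 1)"
proof -
  have sq: "[y\<^sup>2 = a] (mod 3) \<Longrightarrow> a mod 3 = 0 \<or> a mod 3 = 1" for y :: int
  proof -
    assume *: "[y\<^sup>2 = a] (mod 3)"
    have "y mod 3 = 0 \<or> y mod 3 = 1 \<or> y mod 3 = 2" by presburger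
    moreover have "y\<^sup>2 mod 3 = (y mod 3)\<^sup>2 mod 3" by (simp add: power_mod)
    ultimately have "y\<^sup>2 mod 3 = 0 \<or> y\<^sup>2 mod 3 = 1" by auto
    then show ?thesis using * by (simp add: cong_def)
  qed
  have "QuadRes 3 a" if "a mod 3 = 1"
    unfolding QuadRes_def using that by (intro exI[of _ 1]) (simp add: cong_def)
  then show ?thesis
    unfolding Legendre_def using sq by (auto simp: cong_def QuadRes_def)
qed

section \<open>Integrality of Bernoulli numbers and sums of inverse squares\<close>

context prime_ge5
begin

text \<open>Solving the recursion for B_m divides only by m + 1, which is below p.\<close>

lemma pint_bernpoly_0: "m < p - 1 \<Longrightarrow> pint (bernpoly m 0)"
proof (induction m rule: less_induct)
  case (less m)
  show ?case
  proof (cases "m = 0")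
    case False
    have "(\<Sum>i\<le>m. of_nat (Suc m choose i) * bernpoly i 0) =
        (\<Sum>i<m. of_nat (Suc m choose i) * bernpoly i 0) + of_nat (Suc m) * bernpoly m 0"
      by (simp flip: lessThan_Suc_atMost)
    then have "bernpoly m 0 =
        - (\<Sum>i<m. of_nat (Suc m choose i) * bernpoly i 0) / of_nat (Suc m)"
      using bernpoly_0_sum[of m] False
      by (subst nonzero_eq_divide_eq)
        (simp_all add: eq_neg_iff_add_eq_0 add.commute mult.commute del: of_nat_Suc)
    moreover have "\<not> p dvd Suc m" using less.prems by (intro not_dvd_lt) auto
    ultimately show ?thesis
      using less by (simp only:) (intro pint_divide_nat pint_minus pint_sum pint_mult, auto)
  qed (simp add: bernpoly_0_0)
qed

lemma bernpoly_add_p: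
  assumes "m < p - 1" "pint x" "pint y"
  shows "bernpoly m (x + of_nat p * y) \<approx> bernpoly m x"
  unfolding bernpoly_expand[of m "x + of_nat p * y"] bernpoly_expand[of m x]
  using assms
  by (intro rat_cong_sum rat_cong_scale rat_cong_power cong_add_p pint_mult pint_bernpoly_0) auto

lemma inverse_square_cong_power:
  assumes "0 < k" "k < p" shows "1 / of_nat k ^ 2 \<approx> of_nat k ^ (p - 3)"
proof -
  have "[k ^ (p - 1) = 1] (mod p ^ 1)"
    using fermat_theorem[OF prime not_dvd_lt[OF assms]] by simp
  then have "of_nat (k ^ (p - 1)) \<approx> of_nat 1" by (rule rat_cong_of_nat)
  then have "1 / of_nat k ^ 2 * of_nat (k ^ (p - 1)) \<approx> 1 / of_nat k ^ 2 * of_nat 1"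
    by (intro rat_cong_scale pint_inverse_square assms)
  moreover have "1 / of_nat k ^ 2 * of_nat (k ^ (p - 1)) = (of_nat k ^ (p - 3) :: rat)"
  proof -
    have "p - 1 = (p - 3) + 2" using ge5 by simp
    then show ?thesis using assms by (simp only: power_add of_nat_power) simp
  qed
  ultimately show ?thesis using rat_cong_sym[of "of_nat k ^ (p - 3)" "1 / of_nat k ^ 2" 1] by simp
qed

text \<open>By Fermat the sum is a power sum with exponent p - 3, hence B_{p-2}(M+1) / (p-2); the
  boundary value B_{p-2}(1) is 0 because p - 2 is odd and at least 3.\<close>

lemma sum_inverse_squares_bernpoly:
  assumes "M < p"
  shows "(\<Sum>k=1..M. 1 / of_nat k ^ 2) \<approx> - bernpoly (p - 2) (of_nat M + 1) / 2"
proof -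
  let ?S = "\<Sum>k=1..M. of_nat k ^ (p - 3) :: rat"
  have "p - 2 - 1 = p - 3" by simp
  then have *: "of_nat (p - 2) * ?S = bernpoly (p - 2) (of_nat M + 1)"
    using sum_power_bernpoly[of "p - 2" M] bernpoly_odd(2)[of "p - 2"] odd_p ge5 by simp
  \<comment> \<open>Dividing by p - 2 amounts to dividing by -2 modulo p; the second summand is the
    exact error.\<close>
  have "?S = - (of_nat (p - 2) * ?S) / of_nat 2 + of_nat p * (?S / of_nat 2)"
    using ge5 by (simp add: of_nat_diff field_simps)
  moreover have "pint (?S / of_nat 2)"
    using ge5 by (intro pint_divide_nat not_dvd_lt pint_sum pint_power) auto
  ultimately have "?S \<approx> - (of_nat (p - 2) * ?S) / of_nat 2"
    by (intro rat_congI[of "?S / of_nat 2"]) simp_all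
  then have "?S \<approx> - bernpoly (p - 2) (of_nat M + 1) / 2" unfolding * by simp
  moreover have "(\<Sum>k=1..M. 1 / of_nat k ^ 2) \<approx> ?S"
    using assms by (intro rat_cong_sum inverse_square_cong_power) auto
  ultimately show ?thesis by (rule rat_cong_trans[rotated])
qed

text \<open>Here M + 1 = p, so the Bernoulli value is congruent to B_{p-2}(0) = 0.\<close>

lemma sum_inverse_squares: "(\<Sum>k=1..<p. 1 / of_nat k ^ 2) \<approx> 0"
proof -
  have "{1..<p} = {1..p - 1}" using p_pos by auto
  then have "(\<Sum>k=1..<p. 1 / of_nat k ^ 2) \<approx> - bernpoly (p - 2) (of_nat (p - 1) + 1) / of_nat 2"
    using sum_inverse_squares_bernpoly[of "p - 1"] p_pos by simp
  also have "of_nat (p - 1) + 1 = (0 + of_nat p * 1 :: rat)"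
    using p_pos by (simp add: of_nat_diff)
  also have "- bernpoly (p - 2) (0 + of_nat p * 1) / of_nat 2 \<approx> - bernpoly (p - 2) 0 / of_nat 2"
    using ge5 by (intro rat_cong_divide_nat rat_cong_minus bernpoly_add_p not_dvd_lt) auto
  also have "bernpoly (p - 2) 0 = 0"
    using odd_p ge5 by (intro bernpoly_odd(1)) auto
  finally show ?thesis by simp
qed

text \<open>With r = p mod 3 the argument is congruent to 1 - r/3. This is 1/3 for r = 2, and 2/3
  for r = 1, where reflection brings a sign; that sign is the Legendre symbol.\<close>

lemma sum_inverse_squares_third:
  "(\<Sum>k=1..p div 3. 1 / of_nat k ^ 2) \<approx>
     of_int (Legendre (int p) 3) * bernpoly (p - 2) (1 / 3) / 2"
proof -
  let ?B = "bernpoly (p - 2)"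
  let ?r = "p mod 3"
  have third: "pint (x / of_nat 3)" if "pint x" for x
    using that ge5 by (intro pint_divide_nat not_dvd_lt) auto
  have "of_nat p = (3 * of_nat (p div 3) + of_nat ?r :: rat)"
    by (metis mult_div_mod_eq of_nat_add of_nat_mult of_nat_numeral)
  then have eq: "of_nat (p div 3) + 1 = (1 - of_nat ?r / of_nat 3) + of_nat p * (1 / of_nat 3 :: rat)"
    by (simp add: field_simps)
  have "(\<Sum>k=1..p div 3. 1 / of_nat k ^ 2) \<approx>
      - ?B ((1 - of_nat ?r / of_nat 3) + of_nat p * (1 / of_nat 3)) / of_nat 2"
    using sum_inverse_squares_bernpoly[of "p div 3"] p_pos unfolding eq by simp
  also have "- ?B ((1 - of_nat ?r / of_nat 3) + of_nat p * (1 / of_nat 3)) / of_nat 2 \<approx>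
      - ?B (1 - of_nat ?r / of_nat 3) / of_nat 2"
    using ge5 by (intro rat_cong_divide_nat rat_cong_minus bernpoly_add_p not_dvd_lt pint_diff third) auto
  also have "?B (1 - of_nat ?r / of_nat 3) = - of_int (Legendre (int p) 3) * ?B (1 / 3)"
  proof -
    consider "?r = 1" | "?r = 2" using p_mod_3 by blast
    then show ?thesis
    proof cases
      case 1
      then have "int p mod 3 = 1" by presburger
      then show ?thesis using 1 bernpoly_reflect[of "p - 2" "1 / 3"] odd_p ge5
        by (simp add: Legendre_3)
    next
      case 2
      then have "int p mod 3 = 2" by presburger
      then show ?thesis using 2 by (simp add: Legendre_3)
    qed
  qed
  finally show ?thesis by simp
qed

end

section \<open>Sums of inverse squares twisted by a cube root of unity\<close>

text \<open>This is $c_k$: with $\alpha = -\omega$ for a primitive cube root of unity $\omega$, one has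
  $c_k = (-1)^k (\omega^k + \omega^{-k})$.\<close>

definition omega_trace :: "nat \<Rightarrow> int" where
  "omega_trace k = (- 1) ^ k * (3 * of_bool (3 dvd k) - 1)"

text \<open>A primitive sixth root of unity is a root of x^2 - x + 1.\<close>

lemma omega_trace_rec: "omega_trace (k + 2) = omega_trace (k + 1) - omega_trace k"
proof -
  have "3 dvd k \<and> \<not> 3 dvd k + 1 \<and> \<not> 3 dvd k + 2 \<or> \<not> 3 dvd k \<and> 3 dvd k + 1 \<and> \<not> 3 dvd k + 2
      \<or> \<not> 3 dvd k \<and> \<not> 3 dvd k + 1 \<and> 3 dvd k + 2"
    by presburger
  then show ?thesis unfolding omega_trace_def by auto
qed

text \<open>The Chebyshev polynomial of the second kind U_k at 1/2, that is (a^(k+1) - a^(-k-1)) /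
  (a - 1/a) for a primitive sixth root of unity a. Terms with 2j > k vanish.\<close>

definition alt_diag_sum :: "nat \<Rightarrow> int" where
  "alt_diag_sum k = (\<Sum>j\<le>k. (- 1) ^ j * of_nat ((k - j) choose j))"

lemma alt_diag_sum_rec: "alt_diag_sum (k + 2) = alt_diag_sum (k + 1) - alt_diag_sum k"
proof -
  have "alt_diag_sum (k + 2) =
      1 - (\<Sum>j\<le>Suc k. (- 1) ^ j * of_nat ((k + 1 - j) choose (j + 1)))"
    by (simp add: alt_diag_sum_def sum.atMost_Suc_shift[of _ "Suc k"] sum_negf
        del: sum.atMost_Suc binomial_Suc_Suc)
  \<comment> \<open>The term j = k + 1 is 0 choose (k + 2), hence 0. Pascal's rule then splits the
    remaining ones.\<close>
  also have "(\<Sum>j\<le>Suc k. (- 1) ^ j * of_nat ((k + 1 - j) choose (j + 1))) =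
      (\<Sum>j\<le>k. (- 1) ^ j * of_nat ((k + 1 - j) choose (j + 1)) :: int)"
    by simp
  also have "\<dots> = (\<Sum>j\<le>k. (- 1) ^ j * of_nat ((k - j) choose j) +
      (- 1) ^ j * of_nat ((k - j) choose (j + 1)))"
    by (intro sum.cong refl) (simp add: Suc_diff_le algebra_simps)
  also have "\<dots> = alt_diag_sum k + (\<Sum>j\<le>k. (- 1) ^ j * of_nat ((k - j) choose (j + 1)))"
    by (simp add: sum.distrib alt_diag_sum_def)
  also have "(\<Sum>j\<le>k. (- 1) ^ j * of_nat ((k - j) choose (j + 1))) = 1 - alt_diag_sum (k + 1)"
    by (simp add: alt_diag_sum_def sum.atMost_Suc_shift[of _ "k"] sum_negf
        del: sum.atMost_Suc binomial_Suc_Suc)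
  finally show ?thesis by simp
qed

text \<open>The Chebyshev relation 2 T_k = U_k - U_{k-2}. Both sides obey the same second-order
  recurrence, so the induction carries two consecutive indices.\<close>

lemma omega_trace_eq_alt_diag_sum:
  "omega_trace (k + 2) = alt_diag_sum (k + 2) - alt_diag_sum k"
proof -
  have s01: "alt_diag_sum 0 = 1" "alt_diag_sum 1 = 1"
    by (simp_all add: alt_diag_sum_def)
  have s23: "alt_diag_sum 2 = 0" "alt_diag_sum 3 = - 1"
    using alt_diag_sum_rec[of 0] alt_diag_sum_rec[of 1] s01 by (simp_all add: numeral_eq_Suc)
  have "omega_trace (k + 2) = alt_diag_sum (k + 2) - alt_diag_sum k \<and>
      omega_trace (k + 3) = alt_diag_sum (k + 3) - alt_diag_sum (k + 1)"
  proof (induction k)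
    case 0
    have "omega_trace 2 = - 1" "omega_trace 3 = - 2" by (simp_all add: omega_trace_def)
    then show ?case using s01 s23 by (simp flip: numeral_2_eq_2)
  next
    case (Suc k)
    have "omega_trace (k + 4) = alt_diag_sum (k + 4) - alt_diag_sum (k + 2)"
    proof -
      have e: "k + 2 + 2 = k + 4" "k + 2 + 1 = k + 3" by simp_all
      show ?thesis
        using Suc omega_trace_rec[of "k + 2", unfolded e] alt_diag_sum_rec[of "k + 2", unfolded e]
          alt_diag_sum_rec[of k] by linarith
    qed
    with Suc show ?case by (simp add: numeral_eq_Suc)
  qed
  then show ?thesis by blast
qed

text \<open>The two diagonal sums combine termwise, since C(k-j, j) + C(k-j-1, j-1) = (k/j) C(k-j-1,
  j-1). The factor k in front cancels one power of k in c_k / k^2.\<close>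

lemma omega_trace_binomial:
  assumes "k \<ge> 1"
  shows "of_int (omega_trace k) =
    (1 + of_nat k * (\<Sum>j=1..<k. (- 1) ^ j / of_nat j * of_nat ((k - j - 1) choose (j - 1))) :: rat)"
proof (cases "k = 1")
  case False
  then obtain i where k: "k = i + 2" using assms by (metis add.commute add_2_eq_Suc le_Suc_ex le_neq_implies_less Suc_leI Suc_1)
  define f where "f j = (- 1 :: int) ^ j * of_nat ((k - j) choose j)" for j
  define g where "g j = (- 1 :: int) ^ j * of_nat ((k - j - 1) choose (j - 1))" for j
  have A: "alt_diag_sum (i + 2) = 1 + (\<Sum>j=1..<k. f j)"
  proof -
    have "{..k} = insert 0 (insert k {1..<k})" using assms by auto
    then have "alt_diag_sum (i + 2) = f 0 + (f k + (\<Sum>j=1..<k. f j))"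
      using assms by (simp add: alt_diag_sum_def f_def k)
    then show ?thesis using k by (simp add: f_def)
  qed
  have B: "alt_diag_sum i = - (\<Sum>j=1..<k. g j)"
  proof -
    have "(\<Sum>j=1..<k. g j) = (\<Sum>j=0..<Suc i. g (Suc j))"
      unfolding k by (subst sum.shift_bounds_Suc_ivl[symmetric]) simp
    also have "\<dots> = - alt_diag_sum i"
      by (simp add: alt_diag_sum_def g_def k sum_negf atLeast0LessThan lessThan_Suc_atMost
          del: sum.op_ivl_Suc sum.lessThan_Suc)
    finally show ?thesis by simp
  qed
  have "of_int (f j + g j) = of_nat k * ((- 1) ^ j / of_nat j * of_nat ((k - j - 1) choose (j - 1)) :: rat)"
    if "j \<in> {1..<k}" for j
  proof -
    \<comment> \<open>With this parametrization k - j is \<open>Suc m\<close> and k - j - 1 is m, so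
      no truncated subtraction is left.\<close>
    from that obtain l m where lm: "j = Suc l" "k = Suc l + Suc m"
      by (metis atLeastLessThan_iff less_iff_Suc_add Suc_le_D One_nat_def add_Suc_right)
    have "Suc l * (Suc m choose Suc l) = Suc m * (m choose l)"
      using Suc_times_binomial_eq[of m l] by (simp add: mult.commute del: binomial_Suc_Suc)
    then have "(of_nat (Suc l) * of_nat (Suc m choose Suc l) :: rat) = of_nat (Suc m) * of_nat (m choose l)"
      by (simp only: flip: of_nat_mult)
    then have "of_nat (Suc m choose Suc l) = (of_nat (Suc m) * of_nat (m choose l) / of_nat (Suc l) :: rat)"
      by (subst nonzero_eq_divide_eq) (simp_all only: mult.commute of_nat_eq_0_iff Suc_not_Zero not_False_eq_True)
    then show ?thesis
      by (cases "even l") (simp_all add: f_def g_def lm field_simps del: binomial_Suc_Suc)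
  qed
  then have "of_int (\<Sum>j=1..<k. f j + g j) =
      of_nat k * (\<Sum>j=1..<k. (- 1) ^ j / of_nat j * of_nat ((k - j - 1) choose (j - 1)) :: rat)"
    unfolding of_int_sum sum_distrib_left by (intro sum.cong refl) auto
  then show ?thesis
    using omega_trace_eq_alt_diag_sum[of i] A B by (simp add: k sum.distrib)
qed (simp add: omega_trace_def)

section \<open>Folding sums by reflection and by doubling\<close>

context prime_ge5
begin

lemma half_p: "p = 2 * (p div 2) + 1"
  using odd_p by (metis odd_two_times_div_two_succ)

lemma fold_interval:
  "{1..<p} = {1..p div 2} \<union> (\<lambda>i. p - i) ` {1..p div 2}"
  "{1..p div 2} \<inter> (\<lambda>i. p - i) ` {1..p div 2} = {}"
  "inj_on (\<lambda>i. p - i) {1..p div 2}"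
proof -
  show "{1..<p} = {1..p div 2} \<union> (\<lambda>i. p - i) ` {1..p div 2}"
  proof (intro equalityI subsetI)
    fix k assume k: "k \<in> {1..<p}"
    show "k \<in> {1..p div 2} \<union> (\<lambda>i. p - i) ` {1..p div 2}"
    proof (cases "k \<le> p div 2")
      case False
      then have "p - k \<in> {1..p div 2}" "k = p - (p - k)" using k half_p by auto
      then show ?thesis by blast
    qed (use k in auto)
  qed (use half_p ge5 in auto)
  show "{1..p div 2} \<inter> (\<lambda>i. p - i) ` {1..p div 2} = {}" using half_p by auto
  show "inj_on (\<lambda>i. p - i) {1..p div 2}" using half_p by (auto simp: inj_on_def)
qed

lemma sum_fold:
  "(\<Sum>k=1..<p. g k) = (\<Sum>i=1..p div 2. g i + g (p - i) :: 'a :: comm_monoid_add)"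
  by (simp add: fold_interval(1) sum.union_disjoint[OF _ _ fold_interval(2)]
      sum.reindex[OF fold_interval(3)] sum.distrib del: One_nat_def)

lemma prod_fold:
  "(\<Prod>k=1..<p. g k) = (\<Prod>i=1..p div 2. g i * g (p - i) :: 'a :: comm_monoid_mult)"
  by (simp add: fold_interval(1) prod.union_disjoint[OF _ _ fold_interval(2)]
      prod.reindex[OF fold_interval(3)] prod.distrib del: One_nat_def)

text \<open>An even k is 2i; for an odd k the number p - k is even, so k = p - 2i.\<close>

lemma sum_even_odd:
  "(\<Sum>k=1..<p. g k) = (\<Sum>i=1..p div 2. g (2 * i) + g (p - 2 * i) :: 'a :: comm_monoid_add)"
proof -
  have "{1..<p} = (\<lambda>i. 2 * i) ` {1..p div 2} \<union> (\<lambda>i. p - 2 * i) ` {1..p div 2}"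
  proof (intro equalityI subsetI)
    fix k assume k: "k \<in> {1..<p}"
    show "k \<in> (\<lambda>i. 2 * i) ` {1..p div 2} \<union> (\<lambda>i. p - 2 * i) ` {1..p div 2}"
    proof (cases "even k")
      case True
      then obtain i where "k = 2 * i" by blast
      then show ?thesis using k by auto
    next
      case False
      then have "even (p - k)" using odd_p k by simp
      then obtain i where "p - k = 2 * i" by blast
      then have "k = p - 2 * i" "i \<in> {1..p div 2}" using k by auto
      then show ?thesis by blast
    qed
  qed (use half_p in auto)
  moreover have "(\<lambda>i. 2 * i) ` {1..p div 2} \<inter> (\<lambda>i. p - 2 * i) ` {1..p div 2} = {}"
  proof -
    have "2 * i \<noteq> p - 2 * j" if "i \<in> {1..p div 2}" "j \<in> {1..p div 2}" for i j
    proof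
      assume "2 * i = p - 2 * j"
      moreover have "2 * j < p" using that(2) half_p by simp
      ultimately have "p = 2 * (i + j)" by simp
      then show False using odd_p by simp
    qed
    then show ?thesis by blast
  qed
  moreover have "inj_on (\<lambda>i. p - 2 * i) {1..p div 2}" "inj_on (\<lambda>i::nat. 2 * i) {1..p div 2}"
    using half_p by (auto simp: inj_on_def)
  ultimately show ?thesis
    by (simp add: sum.union_disjoint sum.reindex sum.distrib del: One_nat_def)
qed

lemma half_mem:
  assumes "i \<in> {1..p div 2}"
  shows "0 < i" "i < p" "0 < 2 * i" "2 * i < p"
  using assms half_p by auto

lemma sum_inverse_square_fold:
  assumes "\<And>k. pint (g k)"
  shows "(\<Sum>k=1..<p. g k / of_nat k ^ 2) \<approx> (\<Sum>i=1..p div 2. (g i + g (p - i)) / of_nat i ^ 2)"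
proof -
  have "g (p - i) * (1 / of_nat (p - i) ^ 2) \<approx> g (p - i) * (1 / of_nat i ^ 2)"
    if "i \<in> {1..p div 2}" for i
    using half_mem[OF that] assms by (intro rat_cong_scale cong_inverse_square_reflect)
  then have "g i / of_nat i ^ 2 + g (p - i) / of_nat (p - i) ^ 2 \<approx> (g i + g (p - i)) / of_nat i ^ 2"
    if "i \<in> {1..p div 2}" for i
    using that rat_cong_add[OF rat_cong_refl, of "g (p - i) / of_nat (p - i) ^ 2"]
    by (simp add: add_divide_distrib)
  then show ?thesis unfolding sum_fold by (rule rat_cong_sum)
qed

text \<open>The factor 4 comes from (2i)^2. Together with the fold by reflection this gives two
  evaluations of one sum, both over the half range.\<close>

lemma sum_inverse_square_even_odd:
  assumes "\<And>k. pint (g k)"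
  shows "4 * (\<Sum>k=1..<p. g k / of_nat k ^ 2) \<approx>
    (\<Sum>i=1..p div 2. (g (2 * i) + g (p - 2 * i)) / of_nat i ^ 2)"
proof -
  have *: "(4 * g (p - 2 * i)) * (1 / of_nat (p - 2 * i) ^ 2) \<approx> (4 * g (p - 2 * i)) * (1 / of_nat (2 * i) ^ 2)"
    if "i \<in> {1..p div 2}" for i
    using half_mem[OF that] assms by (intro rat_cong_scale cong_inverse_square_reflect pint_mult) auto
  have "4 * (g (2 * i) / of_nat (2 * i) ^ 2 + g (p - 2 * i) / of_nat (p - 2 * i) ^ 2) \<approx>
      (g (2 * i) + g (p - 2 * i)) / of_nat i ^ 2"
    if "i \<in> {1..p div 2}" for i
    using rat_cong_add[OF rat_cong_refl[of "g (2 * i) / of_nat i ^ 2"] *[OF that]]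
    by (simp add: add_divide_distrib algebra_simps power_mult_distrib)
  then show ?thesis unfolding sum_even_odd sum_distrib_left by (rule rat_cong_sum)
qed

text \<open>Folding turns the full sum, which vanishes modulo p, into twice this one.\<close>

lemma half_sum_inverse_squares: "(\<Sum>i=1..p div 2. 1 / of_nat i ^ 2) \<approx> 0"
proof -
  have "(\<Sum>i=1..p div 2. (1 + 1) / of_nat i ^ 2) / of_nat 2 \<approx> 0 / of_nat 2"
    using rat_cong_trans[OF rat_cong_sym[OF sum_inverse_square_fold[of "\<lambda>_. 1"]] sum_inverse_squares] ge5
    by (intro rat_cong_divide_nat not_dvd_lt) auto
  then show ?thesis by (simp add: sum_divide_distrib)
qed

lemma sum_inverse_squares_multiples_of_3:
  "(\<Sum>k=1..<p. of_bool (3 dvd k) / of_nat k ^ 2) = (\<Sum>i=1..p div 3. 1 / of_nat i ^ 2) / (9 :: rat)"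
proof -
  have "(\<Sum>k=1..<p. of_bool (3 dvd k) / of_nat k ^ 2 :: rat) =
      (\<Sum>k\<in>(\<lambda>i. 3 * i) ` {1..p div 3}. of_bool (3 dvd k) / of_nat k ^ 2)"
  proof (intro sum.mono_neutral_right ballI)
    show "(\<lambda>i. 3 * i) ` {1..p div 3} \<subseteq> {1..<p}"
    proof
      fix k assume "k \<in> (\<lambda>i. 3 * i) ` {1..p div 3}"
      then obtain i where "k = 3 * i" "1 \<le> i" "i \<le> p div 3" by auto
      then have "1 \<le> k" "k < p" using p_mod_3 mult_div_mod_eq[of 3 p] by linarith+
      then show "k \<in> {1..<p}" by simp
    qed
    fix k assume k: "k \<in> {1..<p} - (\<lambda>i. 3 * i) ` {1..p div 3}"
    have "\<not> 3 dvd k"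
    proof
      assume "3 dvd k"
      then obtain i where "k = 3 * i" by blast
      then show False using k by auto
    qed
    then show "of_bool (3 dvd k) / of_nat k ^ 2 = (0 :: rat)" by simp
  qed simp
  also have "\<dots> = (\<Sum>i=1..p div 3. 1 / of_nat (3 * i) ^ 2)"
    by (subst sum.reindex) (auto simp: inj_on_def)
  finally show ?thesis by (simp add: power_mult_distrib sum_divide_distrib mult.commute)
qed

text \<open>Linear algebra modulo p in three partial sums over the half range: reflection gives H/9
  = X + Y, doubling gives 4H/9 = X + Z and 4T = 3(X - Z), and X + Y + Z = 0.\<close>

lemma sum_omega_trace:
  "(\<Sum>k=1..<p. of_int (omega_trace k) / of_nat k ^ 2) \<approx> (\<Sum>i=1..p div 3. 1 / of_nat i ^ 2) / 2"
proof -
  let ?m = "p div 2"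
  define T where "T = (\<Sum>k=1..<p. of_int (omega_trace k) / of_nat k ^ 2 :: rat)"
  define H where "H = (\<Sum>i=1..p div 3. 1 / of_nat i ^ 2 :: rat)"
  \<comment> \<open>X, Y and Z collect the i congruent to 0, p and -p modulo 3. As 3 does not divide
    p, these are all residue classes.\<close>
  define X where "X = (\<Sum>i=1..?m. of_bool (3 dvd i) / of_nat i ^ 2 :: rat)"
  define Y where "Y = (\<Sum>i=1..?m. of_bool (3 dvd p - i) / of_nat i ^ 2 :: rat)"
  define Z where "Z = (\<Sum>i=1..?m. of_bool (3 dvd p + i) / of_nat i ^ 2 :: rat)"
  have minus: "3 dvd p - 2 * i \<longleftrightarrow> 3 dvd p + i" if i: "i \<in> {1..?m}" for i
  proof -
    obtain d where "p = 2 * i + d" using half_mem(4)[OF i] by (metis less_imp_add_positive)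
    then have "p - 2 * i = d" "p + i = 3 * i + d" by simp_all
    then show ?thesis by (simp add: dvd_add_right_iff)
  qed
  have two: "3 dvd 2 * i \<longleftrightarrow> 3 dvd i" for i :: nat by presburger
  have "H / 9 \<approx> X + Y"
    using sum_inverse_square_fold[of "\<lambda>k. of_bool (3 dvd k)"]
    unfolding X_def Y_def H_def sum_inverse_squares_multiples_of_3
    by (simp add: add_divide_distrib sum.distrib)
  then obtain z1 where z1: "pint z1" "H / 9 = X + Y + of_nat p * z1"
    unfolding rat_cong_iff by auto
  have "(\<Sum>i=1..?m. (of_bool (3 dvd 2 * i) + of_bool (3 dvd p - 2 * i)) / of_nat i ^ 2) = X + Z"
    unfolding X_def Z_def sum.distrib[symmetric] add_divide_distrib[symmetric]
    by (intro sum.cong refl arg_cong2[where f = "(/)"] arg_cong2[where f = "(+)"])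
      (auto simp: minus two)
  then have "4 * (H / 9) \<approx> X + Z"
    using sum_inverse_square_even_odd[of "\<lambda>k. of_bool (3 dvd k)"]
    unfolding H_def sum_inverse_squares_multiples_of_3 by simp
  then obtain z2 where z2: "pint z2" "4 * (H / 9) = X + Z + of_nat p * z2"
    unfolding rat_cong_iff by auto
  have "X + Y + Z = (\<Sum>i=1..?m. 1 / of_nat i ^ 2)"
    unfolding X_def Y_def Z_def sum.distrib[symmetric] add_divide_distrib[symmetric]
  proof (intro sum.cong refl arg_cong2[where f = "(/)"])
    fix i assume "i \<in> {1..?m}"
    then obtain d where d: "p = i + d" using half_mem(2) by (metis less_imp_add_positive)
    then have "(i + d) mod 3 \<noteq> 0" using p_mod_3 by auto
    then have "3 dvd i \<and> \<not> 3 dvd d \<and> \<not> 3 dvd i + d + i \<or> \<not> 3 dvd i \<and> 3 dvd d \<and> \<not> 3 dvd i + d + i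
        \<or> \<not> 3 dvd i \<and> \<not> 3 dvd d \<and> 3 dvd i + d + i"
      by presburger
    moreover have "p - i = d" "p + i = i + d + i" using d by simp_all
    ultimately have "3 dvd i \<and> \<not> 3 dvd p - i \<and> \<not> 3 dvd p + i \<or> \<not> 3 dvd i \<and> 3 dvd p - i \<and> \<not> 3 dvd p + i
        \<or> \<not> 3 dvd i \<and> \<not> 3 dvd p - i \<and> 3 dvd p + i"
      by simp
    then show "of_bool (3 dvd i) + of_bool (3 dvd p - i) + of_bool (3 dvd p + i) = (1 :: rat)"
      by auto
  qed
  then have "X + Y + Z \<approx> 0" using half_sum_inverse_squares by simp
  then obtain z3 where z3: "pint z3" "X + Y + Z = of_nat p * z3"
    unfolding rat_cong_iff by auto
  have "(\<Sum>i=1..?m. (of_int (omega_trace (2 * i)) + of_int (omega_trace (p - 2 * i))) / of_nat i ^ 2) =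
      3 * (X - Z)"
    unfolding X_def Z_def sum_subtractf[symmetric] diff_divide_distrib[symmetric] sum_distrib_left
  proof (intro sum.cong refl)
    fix i assume i: "i \<in> {1..?m}"
    \<comment> \<open>The two indices have opposite parity, so the constants -1 in the traces
      cancel.\<close>
    have "odd (p - 2 * i)" using half_mem[OF i] odd_p by simp
    then show "(of_int (omega_trace (2 * i)) + of_int (omega_trace (p - 2 * i))) / of_nat i ^ 2 =
        3 * ((of_bool (3 dvd i) - of_bool (3 dvd p + i)) / of_nat i ^ 2 :: rat)"
      by (simp add: omega_trace_def minus[OF i] two)
  qed
  then have "4 * T \<approx> 3 * (X - Z)"
    using sum_inverse_square_even_odd[of "\<lambda>k. of_int (omega_trace k)"] unfolding T_def by simp
  then obtain z4 where z4: "pint z4" "4 * T = 3 * (X - Z) + of_nat p * z4"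
    unfolding rat_cong_iff by auto
  \<comment> \<open>Eliminating gives Z = -H/9 and X = 5H/9 up to multiples of p, so 4T = 2H; the
    bracket collects the errors.\<close>
  have "T = H / 2 + of_nat p * ((z4 - of_nat 3 * z2 - of_nat 6 * z3 - of_nat 6 * z1) / of_nat 4)"
    using z1(2) z2(2) z3(2) z4(2)
    by (simp add: algebra_simps add_divide_distrib diff_divide_distrib)
  moreover have "pint ((z4 - of_nat 3 * z2 - of_nat 6 * z3 - of_nat 6 * z1) / of_nat 4)"
    using ge5 z1(1) z2(1) z3(1) z4(1)
    by (intro pint_divide_nat not_dvd_lt pint_diff pint_mult) auto
  ultimately show ?thesis unfolding T_def H_def by (intro rat_congI) auto
qed

end

section \<open>The central binomial sum modulo p\<close>

definition harm_sum :: "nat \<Rightarrow> rat" where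
  "harm_sum n = (\<Sum>k=1..n. 1 / of_nat k)"

context prime_ge5
begin

lemma not_dvd_fact: "k < p \<Longrightarrow> \<not> p dvd fact k"
  using prime by (simp add: prime_dvd_fact_iff)

text \<open>A binomial coefficient is a polynomial in its upper argument whose denominator k! is
  prime to p.\<close>

lemma gbinomial_cong:
  assumes "k < p" "x \<approx> y" "pint y" shows "x gchoose k \<approx> y gchoose k"
proof -
  have "(\<Prod>i = 0..<k. x - of_nat i) / of_nat (fact k) \<approx> (\<Prod>i = 0..<k. y - of_nat i) / of_nat (fact k)"
    using assms not_dvd_fact
    by (intro rat_cong_divide_nat rat_cong_prod rat_cong_diff pint_diff rat_cong_refl) auto
  then show ?thesis by (simp add: gbinomial_prod_rev)
qed

text \<open>Replace p - a by -a and negate the upper index.\<close>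

lemma binomial_p_minus:
  assumes "a \<ge> 1" "a \<le> p" "k < p"
  shows "of_nat ((p - a) choose k) \<approx> (- 1) ^ k * of_nat ((a + k - 1) choose k)"
proof -
  have "of_nat (p - a) \<approx> - of_nat a"
    using assms by (intro rat_congI[of 1]) (auto simp: of_nat_diff)
  then have "of_nat (p - a) gchoose k \<approx> - of_nat a gchoose k"
    using assms by (intro gbinomial_cong) auto
  also have "- of_nat a gchoose k = (- 1) ^ k * ((of_nat (a + k - 1) :: rat) gchoose k)"
    using assms by (subst gbinomial_minus) (simp add: of_nat_diff)
  finally show ?thesis by (simp only: binomial_gbinomial)
qed

text \<open>The terms at i and p - i cancel modulo p.\<close>

lemma harm_sum_p: "harm_sum (p - 1) \<approx> 0"
proof -
  have "{1..p - 1} = {1..<p}" using p_pos by auto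
  then have "harm_sum (p - 1) = (\<Sum>i=1..p div 2. 1 / of_nat i + 1 / of_nat (p - i))"
    unfolding harm_sum_def by (simp only: sum_fold)
  also have "rat_cong \<dots> (\<Sum>i=1..p div 2. 1 / of_nat i + - 1 / of_nat i) p 1"
    by (intro rat_cong_sum rat_cong_add rat_cong_refl cong_inverse_reflect half_mem)
  finally show ?thesis by simp
qed

lemma sum_choose_lower: "a \<le> n \<Longrightarrow> (\<Sum>k=a..<n. (k - a) choose b) = (n - a) choose (b + 1)"
proof (induction n)
  case (Suc n)
  show ?case
  proof (cases "a = Suc n")
    case False
    then have "a \<le> n" "Suc n - a = Suc (n - a)" using Suc.prems by auto
    then show ?thesis using Suc.IH by simp
  qed simp
qed simp

text \<open>Induction on b. Since (b+1) C(k-a, b+1) = (k - (a+b)) C(k-a, b), division by k leaves a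
  plain binomial sum, closed by the hockey-stick identity, and the previous case; b + 1 is
  invertible modulo p.\<close>

lemma binomial_shift_sum:
  assumes "a \<ge> 1" "a \<le> p" "b < p"
  shows "(\<Sum>k=a..<p. of_nat ((k - a) choose b) / of_nat k) \<approx>
    (- 1) ^ b * of_nat ((a + b - 1) choose b) * (harm_sum b - harm_sum (a - 1))"
  using assms(3)
proof (induction b)
  case 0
  have "{1..p - 1} = {1..a - 1} \<union> {a..<p}" "{1..a - 1} \<inter> {a..<p} = {}" using assms by auto
  then have "(\<Sum>k=a..<p. 1 / of_nat k) = harm_sum (p - 1) - harm_sum (a - 1)"
    unfolding harm_sum_def by (simp add: sum.union_disjoint del: One_nat_def)
  moreover have "harm_sum (p - 1) - harm_sum (a - 1) \<approx> 0 - harm_sum (a - 1)"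
    by (intro rat_cong_diff harm_sum_p rat_cong_refl)
  ultimately show ?case by (simp add: harm_sum_def)
next
  case (Suc b)
  let ?G = "\<lambda>b. \<Sum>k=a..<p. of_nat ((k - a) choose b) / of_nat k :: rat"
  let ?c = "of_nat ((a + b) choose Suc b) :: rat"
  have summand: "of_nat (Suc b) * (of_nat ((k - a) choose Suc b) / of_nat k) =
      of_nat ((k - a) choose b) - of_nat (a + b) * (of_nat ((k - a) choose b) / of_nat k :: rat)"
    if k: "k \<in> {a..<p}" for k
  proof -
    obtain d where d: "k = a + d" using k le_Suc_ex[of a k] by auto
    \<comment> \<open>The subtraction is taken in the rationals because d < b can occur; then both
      sides are 0.\<close>
    have "of_nat (Suc b) * of_nat (d choose Suc b) = (of_nat d - of_nat b) * (of_nat (d choose b) :: rat)"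
    proof (cases "b \<le> d")
      case True
      have "Suc b * (d choose Suc b) = (d - b) * (d choose b)"
        by (simp only: binomial_absorption binomial_absorb_comp)
      then show ?thesis using True by (simp only: of_nat_mult[symmetric] of_nat_diff[symmetric])
    qed (simp add: binomial_eq_0)
    then show ?thesis using assms(1) by (simp add: d field_simps del: of_nat_Suc)
  qed
  have "of_nat (Suc b) * ?G (Suc b) =
      (\<Sum>k=a..<p. of_nat ((k - a) choose b)) - of_nat (a + b) * ?G b"
    unfolding sum_distrib_left sum_subtractf[symmetric] by (intro sum.cong refl summand)
  also have "(\<Sum>k=a..<p. of_nat ((k - a) choose b) :: rat) = of_nat ((p - a) choose Suc b)"
    using sum_choose_lower[OF assms(2), of b] by (simp flip: of_nat_sum)
  finally have rec: "of_nat (Suc b) * ?G (Suc b) = of_nat ((p - a) choose Suc b) - of_nat (a + b) * ?G b" .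
  have absorb: "of_nat (a + b) * of_nat ((a + b - 1) choose b) = of_nat (Suc b) * ?c"
    using binomial_absorption[of b "a + b"] by (simp only: of_nat_mult[symmetric])
  have "of_nat (Suc b) * ?G (Suc b) \<approx> (- 1) ^ Suc b * ?c -
      of_nat (a + b) * ((- 1) ^ b * of_nat ((a + b - 1) choose b) * (harm_sum b - harm_sum (a - 1)))"
    unfolding rec
    using binomial_p_minus[of a "Suc b"] Suc assms
    by (intro rat_cong_diff rat_cong_scale) (auto simp del: binomial_Suc_Suc power_Suc)
  then have "of_nat (Suc b) * ?G (Suc b) / of_nat (Suc b) \<approx> ((- 1) ^ Suc b * ?c -
      of_nat (a + b) * ((- 1) ^ b * of_nat ((a + b - 1) choose b) * (harm_sum b - harm_sum (a - 1)))) / of_nat (Suc b)"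
    using Suc.prems by (intro rat_cong_divide_nat not_dvd_lt) auto
  also have "(- 1) ^ Suc b * ?c -
      of_nat (a + b) * ((- 1) ^ b * of_nat ((a + b - 1) choose b) * (harm_sum b - harm_sum (a - 1))) =
      (- 1) ^ Suc b * ?c + (- 1) ^ Suc b * (of_nat (a + b) * of_nat ((a + b - 1) choose b)) * (harm_sum b - harm_sum (a - 1))"
    by (simp add: algebra_simps del: of_nat_add)
  also have "\<dots> = of_nat (Suc b) * ((- 1) ^ Suc b * ?c * (1 / of_nat (Suc b) + harm_sum b - harm_sum (a - 1)))"
    unfolding absorb by (simp add: field_simps del: of_nat_Suc power_Suc binomial_Suc_Suc)
  also have "1 / of_nat (Suc b) + harm_sum b = harm_sum (Suc b)"
    by (simp add: harm_sum_def)
  finally show ?case by (simp del: of_nat_Suc binomial_Suc_Suc power_Suc)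
qed

text \<open>After the interchange the inner sum over k is the case a = j + 1, b = j - 1 of
  \<open>binomial_shift_sum\<close>, whose harmonic difference is just -1/j. The signs cancel, and
  C(2j-1, j-1) is half of C(2j, j).\<close>

lemma central_binomial_sum_omega_trace:
  "(\<Sum>j=1..<p. of_nat ((2 * j) choose j) / of_nat j ^ 2) \<approx>
    2 * (\<Sum>k=1..<p. of_int (omega_trace k) / of_nat k ^ 2)"
proof -
  let ?t = "\<lambda>j k. (- 1) ^ j / of_nat j * (of_nat ((k - (j + 1)) choose (j - 1)) / of_nat k) :: rat"
  have "of_int (omega_trace k) / of_nat k ^ 2 = 1 / of_nat k ^ 2 + (\<Sum>j=1..<k. ?t j k)"
    if "k \<in> {1..<p}" for k
    using that omega_trace_binomial[of k]
    by (simp add: add_divide_distrib power2_eq_square sum_divide_distrib)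
  then have "(\<Sum>k=1..<p. of_int (omega_trace k) / of_nat k ^ 2) =
      (\<Sum>k=1..<p. 1 / of_nat k ^ 2) + (\<Sum>k=1..<p. \<Sum>j=1..<k. ?t j k)"
    by (simp add: sum.distrib)
  also have "(\<Sum>k=1..<p. \<Sum>j=1..<k. ?t j k) = (\<Sum>k=1..<p. \<Sum>j | j \<in> {1..<p} \<and> j < k. ?t j k)"
    by (intro sum.cong refl) auto
  also have "\<dots> = (\<Sum>j=1..<p. \<Sum>k | k \<in> {1..<p} \<and> j < k. ?t j k)"
    by (rule sum.swap_restrict) auto
  also have "\<dots> = (\<Sum>j=1..<p. (- 1) ^ j / of_nat j * (\<Sum>k=j+1..<p. of_nat ((k - (j + 1)) choose (j - 1)) / of_nat k))"
    unfolding sum_distrib_left by (intro sum.cong refl) auto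
  finally have eq: "(\<Sum>k=1..<p. of_int (omega_trace k) / of_nat k ^ 2) = (\<Sum>k=1..<p. 1 / of_nat k ^ 2) +
    (\<Sum>j=1..<p. (- 1) ^ j / of_nat j * (\<Sum>k=j+1..<p. of_nat ((k - (j + 1)) choose (j - 1)) / of_nat k :: rat))" .
  have summand: "(- 1) ^ j / of_nat j * (\<Sum>k=j+1..<p. of_nat ((k - (j + 1)) choose (j - 1)) / of_nat k) \<approx>
      of_nat ((2 * j) choose j) / of_nat j ^ 2 / of_nat 2" if j: "j \<in> {1..<p}" for j
  proof -
    obtain i where i: "j = Suc i" using j by (cases j) auto
    have "(- 1) ^ j / of_nat j * (\<Sum>k=j+1..<p. of_nat ((k - (j + 1)) choose (j - 1)) / of_nat k) \<approx>
      (- 1) ^ j / of_nat j * ((- 1) ^ (j - 1) * of_nat ((j + 1 + (j - 1) - 1) choose (j - 1)) * (harm_sum (j - 1) - harm_sum (j + 1 - 1)))"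
      using j by (intro rat_cong_scale pint_divide_nat not_dvd_lt pint_power pint_minus binomial_shift_sum) auto
    also have "harm_sum (j - 1) - harm_sum (j + 1 - 1) = - 1 / of_nat j"
      by (simp add: i harm_sum_def)
    also have "(- 1) ^ j / of_nat j * ((- 1) ^ (j - 1) * of_nat ((j + 1 + (j - 1) - 1) choose (j - 1)) * (- 1 / of_nat j)) =
        of_nat ((2 * j - 1) choose (j - 1)) / (of_nat j ^ 2 :: rat)"
    proof -
      have "j + 1 + (j - 1) - 1 = 2 * j - 1" using j by simp
      moreover have "(- 1 :: rat) ^ j = - ((- 1) ^ (j - 1))" by (simp add: i)
      moreover have "(- 1 :: rat) ^ (j - 1) * (- 1) ^ (j - 1) = 1"
        by (simp flip: power_add power_mult_distrib)
      ultimately show ?thesis by (simp add: power2_eq_square)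
    qed
    also have "of_nat ((2 * j - 1) choose (j - 1)) = (of_nat ((2 * j) choose j) / of_nat 2 :: rat)"
    proof -
      have "j * (2 * j choose j) = j * (2 * (2 * j - 1 choose (j - 1)))"
        using binomial_absorption[of i "2 * j"] by (simp add: i)
      then have "2 * j choose j = 2 * (2 * j - 1 choose (j - 1))" using j by simp
      then show ?thesis by simp
    qed
    finally show ?thesis by (simp add: divide_divide_eq_left mult.commute)
  qed
  let ?S = "\<Sum>j=1..<p. of_nat ((2 * j) choose j) / of_nat j ^ 2 :: rat"
  have "(\<Sum>k=1..<p. of_int (omega_trace k) / of_nat k ^ 2) \<approx>
      0 + (\<Sum>j=1..<p. of_nat ((2 * j) choose j) / of_nat j ^ 2 / of_nat 2)"
    unfolding eq by (rule rat_cong_add[OF sum_inverse_squares rat_cong_sum[OF summand]])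
  also have "0 + (\<Sum>j=1..<p. of_nat ((2 * j) choose j) / of_nat j ^ 2 / of_nat 2) = ?S / 2"
    by (simp add: sum_divide_distrib)
  finally have "2 * (\<Sum>k=1..<p. of_int (omega_trace k) / of_nat k ^ 2) \<approx> 2 * (?S / 2)"
    by (rule rat_cong_scale[OF pint_numeral])
  then show ?thesis by (simp add: rat_cong_sym)
qed

lemma central_binomial_sum_bernpoly:
  "(\<Sum>j=1..<p. of_nat ((2 * j) choose j) / of_nat j ^ 2) \<approx>
    of_int (Legendre (int p) 3) * bernpoly (p - 2) (1 / 3) / 2"
proof -
  let ?T = "\<Sum>k=1..<p. of_int (omega_trace k) / of_nat k ^ 2 :: rat"
    and ?H = "\<Sum>i=1..p div 3. 1 / of_nat i ^ 2 :: rat"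
  have "2 * ?T \<approx> 2 * (?H / 2)"
    by (intro rat_cong_scale sum_omega_trace) simp
  also have "2 * (?H / 2) = ?H" by simp
  finally have "2 * ?T \<approx> ?H" .
  from rat_cong_trans[OF rat_cong_trans[OF central_binomial_sum_omega_trace this] sum_inverse_squares_third]
  show ?thesis .
qed

end

section \<open>Binomial coefficients modulo powers of p\<close>

lemma fact_add_prod: "fact (a + b) = (fact a * (\<Prod>r=1..b. a + r) :: nat)"
  by (induction b) (simp_all add: algebra_simps)

lemma sum_blocks:
  fixes f :: "nat \<Rightarrow> 'a :: comm_monoid_add"
  assumes "p \<ge> 1"
  shows "(\<Sum>k=0..n * p. f k) = (\<Sum>j=0..n. f (j * p)) + (\<Sum>j<n. \<Sum>r=1..<p. f (j * p + r))"
proof (induction n)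
  case (Suc n)
  have "(\<Sum>k=0..Suc n * p. f k) = (\<Sum>k=0..n * p. f k) + (\<Sum>k=n * p + 1..n * p + p. f k)"
    using sum.ub_add_nat[of 0 "n * p" f p] by (simp add: add.commute)
  also have "(\<Sum>k=n * p + 1..n * p + p. f k) = (\<Sum>r=1..p. f (n * p + r))"
    using sum.shift_bounds_cl_nat_ivl[of f 1 "n * p" p] by (simp add: add.commute)
  also have "{1..p} = insert p {1..<p}" using assms by auto
  also have "(\<Sum>r\<in>insert p {1..<p}. f (n * p + r)) = f (Suc n * p) + (\<Sum>r=1..<p. f (n * p + r))"
    by (simp add: add.commute)
  finally show ?case using Suc by (simp add: add_ac)
qed simp

section \<open>Lucas' theorem\<close>

context prime_ge5
begin

text \<open>Coefficient form of (1+x)^(N+p) = (1+x)^N (1 + x^p) modulo p.\<close>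

lemma binomial_add_p_cong:
  "[(N + p) choose k = (N choose k) + (if p \<le> k then N choose (k - p) else 0)] (mod p)"
proof -
  have "(N + p) choose k = (\<Sum>i\<le>k. (p choose i) * (N choose (k - i)))"
    by (simp add: vandermonde add.commute)
  moreover have "[(\<Sum>i\<le>k. (p choose i) * (N choose (k - i))) =
      (\<Sum>i\<le>k. (if i = 0 then N choose k else 0) + (if i = p then N choose (k - p) else 0))] (mod p)"
  proof (intro cong_sum)
    fix i
    consider "i = 0" | "i = p" | "i > p" | "0 < i" "i < p" by linarith
    then show "[(p choose i) * (N choose (k - i)) =
        (if i = 0 then N choose k else 0) + (if i = p then N choose (k - p) else 0)] (mod p)"
    proof cases
      case 4
      then have "p dvd p choose i" using prime by (intro dvd_choose_prime) auto
      then show ?thesis using 4 by (simp add: cong_0_iff)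
    qed (use p_pos in \<open>auto simp: binomial_eq_0\<close>)
  qed
  ultimately show ?thesis by (simp add: sum.distrib)
qed

text \<open>The lower digit b may exceed p - 1. This covers C(2r, r) without a case split on a
  carry; b < p + d is what makes both sides vanish for a = 0 and c > 0.\<close>

lemma Lucas:
  assumes "d < p" "b < p + d"
  shows "[(a * p + b) choose (c * p + d) = (a choose c) * (b choose d)] (mod p)"
proof (induction a arbitrary: c)
  case 0
  show ?case
  proof (cases c)
    case (Suc c')
    then have "b < c * p + d" using assms by simp
    then show ?thesis using Suc by (simp add: binomial_eq_0)
  qed simp
next
  case (Suc a)
  have e: "Suc a * p + b = (a * p + b) + p" by simp
  show ?case
  proof (cases c)
    case 0
    then show ?thesis
      using cong_trans[OF binomial_add_p_cong[of "a * p + b" d] ] Suc[of 0] assms(1)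
      unfolding e by simp
  next
    case (Suc c')
    have "[((a * p + b) + p) choose (c * p + d) =
        ((a * p + b) choose (c * p + d)) + ((a * p + b) choose (c' * p + d))] (mod p)"
      using binomial_add_p_cong[of "a * p + b" "c * p + d"] Suc by simp
    also have "[((a * p + b) choose (c * p + d)) + ((a * p + b) choose (c' * p + d)) =
        (a choose c) * (b choose d) + (a choose c') * (b choose d)] (mod p)"
      by (intro cong_add Suc.IH)
    finally show ?thesis unfolding e by (simp add: Suc algebra_simps)
  qed
qed

section \<open>Ljunggren's congruence modulo p^3\<close>

definition block :: "nat \<Rightarrow> nat" where
  "block i = (\<Prod>r=1..<p. i * p + r)"

text \<open>The multiples of p contribute n! p^n; the blocks collect the other factors.\<close>

lemma fact_mult_p: "fact (n * p) = fact n * p ^ n * (\<Prod>i<n. block i)"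
proof (induction n)
  case (Suc n)
  have "{1..p} = insert p {1..<p}" using p_pos by auto
  then have "fact (n * p + p) = fact (n * p) * ((n * p + p) * block n)"
    unfolding fact_add_prod block_def by simp
  then show ?case using Suc by (simp add: algebra_simps)
qed simp

text \<open>First-order expansion in p^2 w, as products of two perturbations carry p^4.\<close>

lemma prod_add_cong:
  fixes a :: "'b \<Rightarrow> rat"
  assumes "finite A" "\<And>x. x \<in> A \<Longrightarrow> pint (a x)" "\<And>x. x \<in> A \<Longrightarrow> pint (1 / a x)"
    "\<And>x. x \<in> A \<Longrightarrow> a x \<noteq> 0" "pint w"
  shows "rat_cong (\<Prod>x\<in>A. a x + of_nat p ^ 2 * w)
    ((\<Prod>x\<in>A. a x) * (1 + of_nat p ^ 2 * w * (\<Sum>x\<in>A. 1 / a x))) p 3"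
  using assms(1-4)
proof (induction A rule: finite_induct)
  case (insert y A)
  let ?P = "\<Prod>x\<in>A. a x" and ?S = "\<Sum>x\<in>A. 1 / a x" and ?u = "of_nat p ^ 2 * w"
  have int: "pint ?P" "pint ?S" "pint (a y)"
    using insert.prems by (auto intro!: pint_prod pint_sum)
  have "rat_cong ((a y + ?u) * (\<Prod>x\<in>A. a x + ?u)) ((a y + ?u) * (?P * (1 + ?u * ?S))) p 3"
  proof (rule rat_cong_scale)
    show "pint (a y + ?u)" using int assms(5) by (intro pint_add pint_mult pint_power pint_of_nat)
    show "rat_cong (\<Prod>x\<in>A. a x + ?u) (?P * (1 + ?u * ?S)) p 3"
      by (rule insert.IH) (use insert.prems in auto)
  qed
  moreover have "rat_cong ((a y + ?u) * (?P * (1 + ?u * ?S))) (a y * ?P * (1 + ?u * (1 / a y + ?S))) p 3"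
  proof (rule rat_congI)
    \<comment> \<open>This witness times p^3 is the single second-order term p^4 w^2 P S.\<close>
    show "pint (of_nat p * w * w * ?P * ?S)" using int assms(5) by (intro pint_mult pint_of_nat)
    have expand: "(b + t ^ 2 * w) * (P * (1 + t ^ 2 * w * S)) =
        b * P * (1 + t ^ 2 * w * (q + S)) + t ^ 3 * (t * w * w * P * S)"
      if "b * q = 1" for b q t P S :: rat
    proof -
      have "b * P * (1 + t ^ 2 * w * (q + S)) = b * P + (b * q) * (P * t ^ 2 * w) + b * P * t ^ 2 * w * S"
        by (simp add: algebra_simps)
      then show ?thesis
        unfolding that by (simp add: algebra_simps power2_eq_square power3_eq_cube)
    qed
    show "(a y + ?u) * (?P * (1 + ?u * ?S)) =
        a y * ?P * (1 + ?u * (1 / a y + ?S)) + of_nat p ^ 3 * (of_nat p * w * w * ?P * ?S)"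
      using insert.prems(3) by (intro expand) simp
  qed
  ultimately have "rat_cong ((a y + ?u) * (\<Prod>x\<in>A. a x + ?u)) (a y * ?P * (1 + ?u * (1 / a y + ?S))) p 3"
    by (rule rat_cong_trans)
  then show ?case using insert.hyps by simp
qed simp

text \<open>Pairing $r$ with $p - r$ gives $(ip + r)(ip + p - r) = r(p - r) + p^2 i(i+1)$, and the term of
  first order in $p^2$ has the coefficient $\sum 1/(r(p-r)) \equiv -\sum 1/r^2 \equiv 0$.\<close>

lemma block_cong: "rat_cong (of_nat (block i)) (of_nat (block 0)) p 3"
proof -
  let ?m = "p div 2"
  define a where "a r = (of_nat (r * (p - r)) :: rat)" for r
  have nd: "\<not> p dvd r * (p - r)" if "r \<in> {1..?m}" for r
    using half_mem[OF that] not_dvd_lt[of r] not_dvd_lt[of "p - r"] prime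
    by (simp add: prime_dvd_mult_iff)
  have nz: "a r \<noteq> 0" if "r \<in> {1..?m}" for r
    using half_mem[OF that] by (simp add: a_def)
  have pa: "pint (a r)" for r by (simp only: a_def pint_of_nat)
  have pia: "pint (1 / a r)" if "r \<in> {1..?m}" for r
    unfolding a_def by (rule pint_inverse_nat[OF nd[OF that]])
  have S: "(\<Sum>r=1..?m. 1 / a r) \<approx> 0"
  proof -
    have "1 / of_nat r * (1 / of_nat (p - r)) \<approx> 1 / of_nat r * (- 1 / of_nat r)" if "r \<in> {1..?m}" for r
      using half_mem[OF that] by (intro rat_cong_scale pint_inverse_nat cong_inverse_reflect not_dvd_lt)
    then have "(\<Sum>r=1..?m. 1 / a r) \<approx> (\<Sum>r=1..?m. - (1 / of_nat r ^ 2))"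
      by (intro rat_cong_sum) (simp add: a_def power2_eq_square)
    also have "(\<Sum>r=1..?m. - (1 / of_nat r ^ 2)) = - (\<Sum>r=1..?m. 1 / of_nat r ^ 2 :: rat)"
      by (rule sum_negf)
    also have "\<dots> \<approx> - 0" by (intro rat_cong_minus half_sum_inverse_squares)
    finally show ?thesis by simp
  qed
  have eq: "of_nat (block i) = (\<Prod>r=1..?m. a r + of_nat p ^ 2 * of_nat (i * (i + 1)))" for i
  proof -
    have "block i = (\<Prod>r=1..?m. (i * p + r) * (i * p + (p - r)))"
      unfolding block_def by (rule prod_fold)
    also have "\<dots> = (\<Prod>r=1..?m. r * (p - r) + p ^ 2 * (i * (i + 1)))"
    proof (intro prod.cong refl)
      fix r assume "r \<in> {1..?m}"
      then obtain d where d: "p = r + d" using half_mem(2) less_imp_add_positive by metis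
      then have "p - r = d" by simp
      then show "(i * p + r) * (i * p + (p - r)) = r * (p - r) + p ^ 2 * (i * (i + 1))"
        using d by (simp add: algebra_simps power2_eq_square)
    qed
    finally show ?thesis by (simp add: a_def)
  qed
  let ?w = "of_nat (i * (i + 1)) :: rat"
  have "rat_cong (of_nat (block i)) ((\<Prod>r=1..?m. a r) * (1 + of_nat p ^ 2 * ?w * (\<Sum>r=1..?m. 1 / a r))) p 3"
    unfolding eq by (intro prod_add_cong pa pia nz pint_of_nat finite_atLeastAtMost)
  moreover have "rat_cong ((\<Prod>r=1..?m. a r) * (1 + of_nat p ^ 2 * ?w * (\<Sum>r=1..?m. 1 / a r)))
      ((\<Prod>r=1..?m. a r) * (1 + of_nat p ^ 2 * (?w * 0))) p 3"
  proof (intro rat_cong_scale rat_cong_add rat_cong_refl)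
    show "pint (\<Prod>r=1..?m. a r)" by (intro pint_prod pa)
    have "?w * (\<Sum>r=1..?m. 1 / a r) \<approx> ?w * 0" by (rule rat_cong_scale[OF pint_of_nat S])
    from rat_cong_lift[OF this]
    show "rat_cong (of_nat p ^ 2 * ?w * (\<Sum>r=1..?m. 1 / a r)) (of_nat p ^ 2 * (?w * 0)) p 3"
      by (simp only: mult.assoc)
  qed
  ultimately have "rat_cong (of_nat (block i)) ((\<Prod>r=1..?m. a r) * (1 + of_nat p ^ 2 * (?w * 0))) p 3"
    by (rule rat_cong_trans)
  then show ?thesis using eq[of 0] by simp
qed

lemma block_0_not_dvd: "\<not> p dvd block 0"
proof -
  have "{1..<p} = {1..p - 1}" using p_pos by auto
  then have "block 0 = fact (p - 1)" by (simp add: block_def fact_prod)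
  then show ?thesis using not_dvd_fact[of "p - 1"] p_pos by simp
qed

lemma prod_block_cong: "rat_cong (of_nat (\<Prod>i<n. block i)) (of_nat (block 0 ^ n)) p 3"
proof -
  have "rat_cong (\<Prod>i<n. of_nat (block i)) (\<Prod>i<n. of_nat (block 0)) p 3"
    by (intro rat_cong_prod block_cong) auto
  then show ?thesis by simp
qed

text \<open>Write the three factorials by \<open>fact_mult_p\<close>: the factorials and powers of p
  cancel, leaving products of blocks. Each block is congruent to (p-1)!, which is prime to p, and
  both sides have n blocks.\<close>

lemma binomial_mult_p_cong:
  assumes "j \<le> n" shows "rat_cong (of_nat ((n * p) choose (j * p))) (of_nat (n choose j)) p 3"
proof -
  let ?B = "\<lambda>n. \<Prod>i<n. block i" and ?w = "block 0"
  obtain l where n: "n = j + l" using assms le_Suc_ex by blast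
  let ?X = "(n * p) choose (j * p)"
  have "(fact j * fact l * p ^ n) * (?X * (?B j * ?B l)) =
      (fact j * p ^ j * ?B j) * (fact l * p ^ l * ?B l) * ?X"
    by (simp only: n power_add mult_ac)
  also have "\<dots> = fact (j * p) * fact (l * p) * ?X" by (simp only: fact_mult_p)
  also have "\<dots> = fact (n * p)"
    using binomial_fact_lemma[of "j * p" "n * p"] by (simp add: n algebra_simps)
  also have "\<dots> = (fact j * fact l * (n choose j)) * p ^ n * ?B n"
    unfolding fact_mult_p using binomial_fact_lemma[of j n] by (simp add: n)
  also have "\<dots> = (fact j * fact l * p ^ n) * ((n choose j) * ?B n)"
    by (simp only: mult_ac)
  finally have "(fact j * fact l * p ^ n) * (?X * (?B j * ?B l)) =
      (fact j * fact l * p ^ n) * ((n choose j) * ?B n)" .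
  then have "((n * p) choose (j * p)) * (?B j * ?B l) = (n choose j) * ?B n"
    using p_pos by simp
  then have eq: "of_nat ((n * p) choose (j * p)) * (of_nat (?B j) * of_nat (?B l)) =
      (of_nat (n choose j) * of_nat (?B n) :: rat)"
    by (simp only: of_nat_mult[symmetric])
  have "rat_cong (of_nat ((n * p) choose (j * p)) * (of_nat (?B j) * of_nat (?B l)))
      (of_nat ((n * p) choose (j * p)) * (of_nat (?w ^ j) * of_nat (?w ^ l))) p 3"
    by (rule rat_cong_scale[OF pint_of_nat rat_cong_mult[OF prod_block_cong prod_block_cong pint_of_nat pint_of_nat]])
  then have 1: "rat_cong (of_nat ((n * p) choose (j * p)) * of_nat (?w ^ n)) (of_nat (n choose j) * of_nat (?B n)) p 3"
    unfolding eq by (simp add: n power_add rat_cong_sym)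
  have 2: "rat_cong (of_nat (n choose j) * of_nat (?B n)) (of_nat (n choose j) * of_nat (?w ^ n)) p 3"
    by (rule rat_cong_scale[OF pint_of_nat prod_block_cong])
  have nd: "\<not> p dvd ?w ^ n" using block_0_not_dvd prime prime_dvd_power by blast
  then have "of_nat (?w ^ n) \<noteq> (0 :: rat)" by (metis dvd_0_right of_nat_eq_0_iff)
  then show ?thesis using rat_cong_divide_nat[OF nd rat_cong_trans[OF 1 2]] by simp
qed

section \<open>Evaluation of the single terms and of the whole sum\<close>

lemma multiple_term_cong:
  assumes "j \<le> n"
  shows "rat_cong (of_nat (((n * p) choose (j * p))^2 * ((2 * (j * p)) choose (j * p))))
    (of_nat ((n choose j)^2 * ((2 * j) choose j))) p 3"
proof -
  have "2 * (j * p) = 2 * j * p" by simp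
  then show ?thesis
    using rat_cong_mult[OF rat_cong_power[OF binomial_mult_p_cong[OF assms], of 2] binomial_mult_p_cong[of j "2 * j"]]
    by (simp only: of_nat_mult of_nat_power) (simp add: pint_power)
qed

text \<open>From k C(np, k) = np C(np-1, k-1) with k = jp + r prime to p. Lucas and C(p-1, r-1) =
  (-1)^(r-1) modulo p give the cofactor e up to a sign, which the square removes; n C(n-1, j) =
  (n-j) C(n, j) brings in n - j.\<close>

lemma nonmultiple_binomial:
  assumes "j < n" "r \<in> {1..<p}"
  obtains e where "of_nat ((n * p) choose (j * p + r)) = of_nat p * e"
    "e ^ 2 \<approx> of_nat ((n choose j)^2 * (n - j)^2) / of_nat r ^ 2" "pint e"
proof -
  let ?k = "j * p + r"
  let ?c = "(n * p - 1) choose (?k - 1)"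
  define e where "e = of_nat n * of_nat ?c * (1 / of_nat ?k :: rat)"
  have r: "0 < r" "r < p" using assms by auto
  have nd: "\<not> p dvd r" "\<not> p dvd ?k"
    using not_dvd_lt[OF r] by (simp_all add: dvd_add_right_iff)
  have "?k * ((n * p) choose ?k) = n * p * ?c"
    using binomial_absorption[of "?k - 1" "n * p"] r by simp
  then have "of_nat ?k * of_nat ((n * p) choose ?k) = (of_nat n * of_nat p * of_nat ?c :: rat)"
    by (simp only: of_nat_mult[symmetric])
  then have e: "of_nat ((n * p) choose ?k) = of_nat p * e"
    using r by (simp add: e_def nonzero_eq_divide_eq mult_ac del: of_nat_add of_nat_mult)
  \<comment> \<open>Base p digits of np - 1 and k - 1; no borrow occurs in k - 1 as r > 0.\<close>
  have "?c = ((n - 1) * p + (p - 1)) choose (j * p + (r - 1))"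
    using assms(1) r p_pos by (simp add: diff_mult_distrib)
  then have "[?c = ((n - 1) choose j) * ((p - 1) choose (r - 1))] (mod p)"
    using Lucas[of "r - 1" "p - 1" "n - 1" j] r by simp
  then have "of_nat ?c \<approx> of_nat (((n - 1) choose j) * ((p - 1) choose (r - 1)))"
    by (intro rat_cong_of_nat) simp
  also have "of_nat (((n - 1) choose j) * ((p - 1) choose (r - 1))) =
      of_nat ((n - 1) choose j) * (of_nat ((p - 1) choose (r - 1)) :: rat)" by simp
  also have "rat_cong \<dots> (of_nat ((n - 1) choose j) * ((- 1) ^ (r - 1) * of_nat ((1 + (r - 1) - 1) choose (r - 1)))) p 1"
    using r by (intro rat_cong_scale binomial_p_minus) auto
  finally have c: "of_nat ?c \<approx> of_nat ((n - 1) choose j) * (- 1) ^ (r - 1)" by simp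
  have k: "1 / of_nat ?k \<approx> 1 / of_nat r"
  proof (rule cong_inverse)
    show "of_nat ?k \<approx> 1 * of_nat r" by (rule rat_congI[of "of_nat j"]) (auto simp: mult.commute)
  qed (use nd in auto)
  have "e \<approx> of_nat n * (of_nat ((n - 1) choose j) * (- 1) ^ (r - 1)) * (1 / of_nat r)"
    unfolding e_def
    using nd by (intro rat_cong_mult rat_cong_scale c k pint_mult pint_power pint_minus pint_inverse_nat) auto
  also have "of_nat n * (of_nat ((n - 1) choose j) * (- 1) ^ (r - 1)) * (1 / of_nat r) =
      of_nat ((n choose j) * (n - j)) * (- 1) ^ (r - 1) * (1 / of_nat r :: rat)"
    using binomial_absorb_comp[of n j] by (simp add: mult_ac flip: of_nat_mult)
  finally have "e ^ 2 \<approx> (of_nat ((n choose j) * (n - j)) * (- 1) ^ (r - 1) * (1 / of_nat r)) ^ 2"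
    using nd by (intro rat_cong_power pint_mult pint_power pint_minus pint_inverse_nat) auto
  also have "(of_nat ((n choose j) * (n - j)) * (- 1) ^ (r - 1) * (1 / of_nat r)) ^ 2 =
      of_nat ((n choose j)^2 * (n - j)^2) / (of_nat r ^ 2 :: rat)"
    by (simp add: power_mult_distrib power_divide flip: power_mult)
  finally have square: "e ^ 2 \<approx> of_nat ((n choose j)^2 * (n - j)^2) / of_nat r ^ 2" .
  have "pint e"
    unfolding e_def using nd by (intro pint_mult pint_inverse_nat pint_of_nat)
  with e square show thesis by (rule that)
qed

lemma nonmultiple_term_cong:
  assumes "j < n" "r \<in> {1..<p}"
  shows "rat_cong (of_nat (((n * p) choose (j * p + r))^2 * ((2 * (j * p + r)) choose (j * p + r))))
    (of_nat p ^ 2 * (of_nat ((n choose j)^2 * ((2 * j) choose j) * (n - j)^2) * (of_nat ((2 * r) choose r) / of_nat r ^ 2))) p 3"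
proof -
  obtain e where e: "of_nat ((n * p) choose (j * p + r)) = of_nat p * e"
    "e ^ 2 \<approx> of_nat ((n choose j)^2 * (n - j)^2) / of_nat r ^ 2" "pint e"
    using nonmultiple_binomial[OF assms] .
  let ?d = "(2 * (j * p + r)) choose (j * p + r)"
  have r: "0 < r" "r < p" using assms by auto
  have *: "2 * (j * p + r) = 2 * j * p + 2 * r" by simp
  have "[?d = ((2 * j) choose j) * ((2 * r) choose r)] (mod p ^ 1)"
    using Lucas[of r "2 * r" "2 * j" j] r unfolding * by simp
  then have "of_nat ?d \<approx> of_nat (((2 * j) choose j) * ((2 * r) choose r))"
    by (rule rat_cong_of_nat)
  then have "e ^ 2 * of_nat ?d \<approx> of_nat ((n choose j)^2 * (n - j)^2) / of_nat r ^ 2 *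
      of_nat (((2 * j) choose j) * ((2 * r) choose r))"
    using e pint_mult[OF pint_of_nat pint_inverse_square[OF r], of "(n choose j)^2 * (n - j)^2"]
    by (intro rat_cong_mult) auto
  from rat_cong_lift[OF this] show ?thesis
    by (simp add: e(1) power_mult_distrib mult_ac)
qed

lemma Cstar_mult_p:
  assumes "n > 0"
  shows "rat_cong (of_nat (Cstar (n * p)))
    (of_nat (Cstar n) + of_nat p ^ 2 * of_int (Legendre (int p) 3) * bernpoly (p - 2) (1 / 3) * Cstar_cal n) p 3"
proof -
  let ?f = "\<lambda>k. of_nat (((n * p) choose k)^2 * ((2 * k) choose k)) :: rat"
  let ?S = "\<Sum>r=1..<p. of_nat ((2 * r) choose r) / of_nat r ^ 2 :: rat"
  let ?L = "of_int (Legendre (int p) 3) * bernpoly (p - 2) (1 / 3)"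
  let ?c = "\<Sum>j<n. of_nat ((n choose j)^2 * ((2 * j) choose j) * (n - j)^2) :: rat"
  have "of_nat (Cstar (n * p)) = (\<Sum>k=0..n * p. ?f k)" by (simp add: Cstar_def)
  also have "\<dots> = (\<Sum>j=0..n. ?f (j * p)) + (\<Sum>j<n. \<Sum>r=1..<p. ?f (j * p + r))"
    using p_pos by (intro sum_blocks) simp
  finally have 1: "of_nat (Cstar (n * p)) = \<dots>" .
  have 2: "rat_cong (\<Sum>j=0..n. ?f (j * p)) (of_nat (Cstar n)) p 3"
    unfolding Cstar_def of_nat_sum by (intro rat_cong_sum multiple_term_cong) auto
  have "rat_cong (\<Sum>j<n. \<Sum>r=1..<p. ?f (j * p + r))
      (\<Sum>j<n. \<Sum>r=1..<p. of_nat p ^ 2 * (of_nat ((n choose j)^2 * ((2 * j) choose j) * (n - j)^2) *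
        (of_nat ((2 * r) choose r) / of_nat r ^ 2))) p 3"
    by (intro rat_cong_sum nonmultiple_term_cong) auto
  \<comment> \<open>Each summand is a function of j times a function of r, so the double sum is a
    product.\<close>
  also have "(\<Sum>j<n. \<Sum>r=1..<p. of_nat p ^ 2 * (of_nat ((n choose j)^2 * ((2 * j) choose j) * (n - j)^2) *
        (of_nat ((2 * r) choose r) / of_nat r ^ 2))) = of_nat p ^ 2 * (?c * ?S)"
    unfolding sum_product unfolding sum_distrib_left ..
  also have "rat_cong \<dots> (of_nat p ^ 2 * (?c * (?L / 2))) p 3"
    by (intro rat_cong_lift rat_cong_scale central_binomial_sum_bernpoly pint_sum pint_of_nat)
  finally have 3: "rat_cong (\<Sum>j<n. \<Sum>r=1..<p. ?f (j * p + r)) (of_nat p ^ 2 * (?c * (?L / 2))) p 3" .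
  \<comment> \<open>As n > 0, the bound n - 1 is not truncated. The factor 1/2 in
    \<open>Cstar_cal\<close> is the one from \<open>central_binomial_sum_bernpoly\<close>.\<close>
  have "{0..n - 1} = {..<n}" using assms by auto
  then have "Cstar_cal n = ?c / 2" by (simp add: Cstar_cal_def)
  then have 4: "of_nat p ^ 2 * (?c * (?L / 2)) = of_nat p ^ 2 * of_int (Legendre (int p) 3) * bernpoly (p - 2) (1 / 3) * Cstar_cal n"
    by simp
  show ?thesis using rat_cong_add[OF 2 3] unfolding 1 4 .
qed

end

theorem theorem2p2:
  fixes p n :: nat
  assumes "prime p" and "p \<ge> 5" and "n > 0"
  shows "rat_cong (of_nat (Cstar (n*p)))
           (of_nat (Cstar n) + of_nat p ^ 2 * of_int (Legendre (int p) 3)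
              * bernpoly (p - 2) (1/3) * Cstar_cal n) p 3"
proof -
  interpret prime_ge5 p using assms by unfold_locales
  show ?thesis using assms(3) by (rule Cstar_mult_p)
qed

end
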